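(* Let $F$ be a finitely generated free group of rank $\geq 2$, let $\phi: F \to F$ be a monomorphism, and let $G=\langle F, t \mid tft^{-1}=\phi(f) \ \ \forall f \in F \rangle$ be the associated ascending HNN extension. Then $G$ fails to have the finitely generated intersection property.
   Context: A group has the finitely generated intersection property (FGIP) if the intersection of any two of its finitely generated subgroups is also finitely generated. For a monomorphism $\phi: F\to F$ (injective homomorphism, not necessarily surjective) of a free group $F$, the ascending HNN extension associated to $\phi$ is the group $\langle F, t \mid tft^{-1}=\phi(f) \ \ \forall f \in F \rangle$; when $\phi$ is surjective this is the free-by-cyclic group $F\rtimes_\phi \mathbb{Z}$, and when $\phi$ is not surjective it is called a proper ascending HNN extension. *)

theory Defs
  imports "HOL-Algebra.Generated_Groups"
begin

text \<open>
  Group presentations. A word is a list of signed letters: \<open>(x, True)\<close> stands for the generator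
  \<open>x\<close> and \<open>(x, False)\<close> for its formal inverse. A relation \<open>u = v\<close> is the pair \<open>(u, v)\<close> of words.
\<close>

type_synonym 'a word = "('a \<times> bool) list"

definition words :: "'a set \<Rightarrow> 'a word set" where
  "words S = lists (S \<times> UNIV)"

inductive_set pres_rel :: "'a set \<Rightarrow> ('a word \<times> 'a word) set \<Rightarrow> ('a word \<times> 'a word) set"
  for S :: "'a set" and R :: "('a word \<times> 'a word) set" where
  refl: "w \<in> words S \<Longrightarrow> (w, w) \<in> pres_rel S R"
| sym: "(u, v) \<in> pres_rel S R \<Longrightarrow> (v, u) \<in> pres_rel S R"
| trans: "(u, v) \<in> pres_rel S R \<Longrightarrow> (v, w) \<in> pres_rel S R \<Longrightarrow> (u, w) \<in> pres_rel S R"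
| cancel: "u \<in> words S \<Longrightarrow> v \<in> words S \<Longrightarrow> x \<in> S \<Longrightarrow>
    (u @ [(x, b), (x, \<not> b)] @ v, u @ v) \<in> pres_rel S R"
| relation: "(r, s) \<in> R \<Longrightarrow> r \<in> words S \<Longrightarrow> s \<in> words S \<Longrightarrow> u \<in> words S \<Longrightarrow> v \<in> words S \<Longrightarrow>
    (u @ r @ v, u @ s @ v) \<in> pres_rel S R"

definition presented_group :: "'a set \<Rightarrow> ('a word \<times> 'a word) set \<Rightarrow> 'a word set monoid" where
  "presented_group S R =
    \<lparr>carrier = words S // pres_rel S R,
     mult = (\<lambda>A B. \<Union>u\<in>A. \<Union>v\<in>B. pres_rel S R `` {u @ v}),
     one = pres_rel S R `` {[]}\<rparr>"

definition free_group :: "'a set \<Rightarrow> 'a word set monoid" where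
  "free_group S = presented_group S {}"

text \<open>
  In the presentation of the ascending HNN extension, \<open>Some f\<close> is the generator given by the
  element \<open>f\<close> of \<open>F\<close> and \<open>None\<close> is the stable letter \<open>t\<close>. The multiplication table of \<open>F\<close> supplies
  the relations of \<open>F\<close> that the notation \<open>\<langle>F, t | \<dots>\<rangle>\<close> leaves implicit.
\<close>

definition ascending_HNN ::
    "('a, 'm) monoid_scheme \<Rightarrow> ('a \<Rightarrow> 'a) \<Rightarrow> 'a option word set monoid" where
  "ascending_HNN F \<phi> =
    presented_group (insert None (Some ` carrier F))
      ({([(Some f, True), (Some g, True)], [(Some (f \<otimes>\<^bsub>F\<^esub> g), True)]) | f g.
          f \<in> carrier F \<and> g \<in> carrier F} \<union>
       {([(None, True), (Some f, True), (None, False)], [(Some (\<phi> f), True)]) | f.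
          f \<in> carrier F})"

definition fg_subgroup :: "'a set \<Rightarrow> ('a, 'm) monoid_scheme \<Rightarrow> bool" where
  "fg_subgroup H G \<longleftrightarrow> (\<exists>A. finite A \<and> A \<subseteq> carrier G \<and> H = generate G A)"

definition FGIP :: "('a, 'm) monoid_scheme \<Rightarrow> bool" where
  "FGIP G \<longleftrightarrow> (\<forall>H K. fg_subgroup H G \<longrightarrow> fg_subgroup K G \<longrightarrow> fg_subgroup (H \<inter> K) G)"

lemma words_append [simp]: "u @ v \<in> words S \<longleftrightarrow> u \<in> words S \<and> v \<in> words S"
  by (auto simp: words_def)

lemma words_Nil [simp]: "[] \<in> words S"
  by (simp add: words_def)

lemma pres_rel_words: "(u, v) \<in> pres_rel S R \<Longrightarrow> u \<in> words S \<and> v \<in> words S"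
  by (induction rule: pres_rel.induct) (auto simp: words_def)

lemma equiv_pres_rel: "equiv (words S) (pres_rel S R)"
proof (rule equivI)
  show "pres_rel S R \<subseteq> words S \<times> words S"
    using pres_rel_words by fastforce
  show "refl_on (words S) (pres_rel S R)"
    by (auto simp: refl_on_def intro: pres_rel.refl dest: pres_rel_words)
  show "sym (pres_rel S R)"
    by (auto simp: sym_def intro: pres_rel.sym)
  show "trans (pres_rel S R)"
    by (meson transI pres_rel.trans)
qed

lemma pres_rel_append_context:
  assumes "(u, v) \<in> pres_rel S R" "p \<in> words S" "q \<in> words S"
  shows "(p @ u @ q, p @ v @ q) \<in> pres_rel S R"
  using assms
proof (induction rule: pres_rel.induct)
  case (cancel u v x b)
  then show ?case
    using pres_rel.cancel[of "p @ u" S "v @ q" x b R] by simp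
next
  case (relation r s u v)
  then show ?case
    using pres_rel.relation[of r s R S "p @ u" "v @ q"] by simp
qed (auto intro: pres_rel.intros)

lemma pres_rel_append:
  assumes "(u, u') \<in> pres_rel S R" "(v, v') \<in> pres_rel S R"
  shows "(u @ v, u' @ v') \<in> pres_rel S R"
  using pres_rel_append_context[OF assms(1), of "[]" v]
    pres_rel_append_context[OF assms(2), of u' "[]"]
    pres_rel_words[OF assms(1)] pres_rel_words[OF assms(2)]
  by (auto intro: pres_rel.trans)

lemma presented_group_mult:
  assumes "u \<in> words S" "v \<in> words S"
  shows "pres_rel S R `` {u} \<otimes>\<^bsub>presented_group S R\<^esub> pres_rel S R `` {v} = pres_rel S R `` {u @ v}"
proof -
  have c: "congruent2 (pres_rel S R) (pres_rel S R) (\<lambda>u v. pres_rel S R `` {u @ v})"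
    by (intro congruent2I' equiv_class_eq[OF equiv_pres_rel] pres_rel_append)
  show ?thesis
    using UN_equiv_class2[OF equiv_pres_rel equiv_pres_rel c assms]
    by (simp add: presented_group_def)
qed

lemma word_inverse:
  "w \<in> words S \<Longrightarrow> (rev (map (apsnd Not) w) @ w, []) \<in> pres_rel S R"
proof (induction w)
  case Nil
  then show ?case by (simp add: pres_rel.refl)
next
  case (Cons a w)
  obtain x b where a: "a = (x, b)" by (cases a)
  have x: "x \<in> S" and w: "w \<in> words S"
    using Cons.prems by (auto simp: a words_def)
  have "rev (map (apsnd Not) w) \<in> words S"
    using w by (force simp: words_def)
  from pres_rel.cancel[OF this w x, of "\<not> b" R] Cons.IH[OF w] show ?case
    by (auto simp: a intro: pres_rel.trans)
qed

lemma group_presented_group: "group (presented_group S R)"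
proof (rule groupI)
  let ?G = "presented_group S R"
  have car: "\<exists>u\<in>words S. A = pres_rel S R `` {u}" if "A \<in> carrier ?G" for A
    using that by (auto simp: presented_group_def quotient_def)
  have cls: "pres_rel S R `` {u} \<in> carrier ?G" if "u \<in> words S" for u
    using that by (auto simp: presented_group_def intro: quotientI)
  have one: "\<one>\<^bsub>?G\<^esub> = pres_rel S R `` {[]}"
    by (simp add: presented_group_def)
  show "\<one>\<^bsub>?G\<^esub> \<in> carrier ?G"
    by (simp add: one cls)
  fix A assume A: "A \<in> carrier ?G"
  then obtain u where u: "u \<in> words S" "A = pres_rel S R `` {u}"
    using car by blast
  show "\<one>\<^bsub>?G\<^esub> \<otimes>\<^bsub>?G\<^esub> A = A"
    by (simp add: one u presented_group_mult)
  have inv: "rev (map (apsnd Not) u) \<in> words S"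
    using u by (force simp: words_def)
  have "pres_rel S R `` {rev (map (apsnd Not) u)} \<otimes>\<^bsub>?G\<^esub> A = \<one>\<^bsub>?G\<^esub>"
    using equiv_class_eq[OF equiv_pres_rel word_inverse[OF u(1)]]
    by (simp add: one u inv presented_group_mult)
  then show "\<exists>B\<in>carrier ?G. B \<otimes>\<^bsub>?G\<^esub> A = \<one>\<^bsub>?G\<^esub>"
    using cls[OF inv] by blast
  fix B assume "B \<in> carrier ?G"
  then obtain v where v: "v \<in> words S" "B = pres_rel S R `` {v}"
    using car by blast
  show "A \<otimes>\<^bsub>?G\<^esub> B \<in> carrier ?G"
    by (simp add: u v presented_group_mult cls)
  fix C assume "C \<in> carrier ?G"
  then obtain w where w: "w \<in> words S" "C = pres_rel S R `` {w}"
    using car by blast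
  show "A \<otimes>\<^bsub>?G\<^esub> B \<otimes>\<^bsub>?G\<^esub> C = A \<otimes>\<^bsub>?G\<^esub> (B \<otimes>\<^bsub>?G\<^esub> C)"
    by (simp add: u v w presented_group_mult)
qed

end

theory Submission
  imports Defs
begin

text \<open>
  Let \<open>G = \<langle>F, t\<rangle>\<close> be the extension. For \<open>w\<close> in \<open>F\<close> put \<open>y = w t\<close>; conjugation by \<open>y\<close> acts on \<open>F\<close>
  as the injective endomorphism \<open>\<psi>(x) = w \<phi>(x) w\<inverse>\<close>. For \<open>f\<close> in \<open>F\<close> the two finitely generated
  subgroups are \<open>\<langle>f, y\<rangle>\<close> and \<open>F\<close>. Counting occurrences of \<open>t\<close> shows that their intersection lies
  in the subgroup generated by all conjugates \<open>y\<^sup>i f y\<^sup>-\<^sup>i\<close> with \<open>i \<in> \<int>\<close>, and it contains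
  those with \<open>i \<ge> 0\<close>, which are the elements \<open>\<psi>\<^sup>i(f)\<close>. A finite generating set of the intersection
  would involve only finitely many indices, so, after shifting by a power of \<open>y\<close>, some \<open>\<psi>\<^sup>k(f)\<close> would
  lie in \<open>\<langle>f, \<psi>(f), \<dots>, \<psi>\<^sup>k\<^sup>-\<^sup>1(f)\<rangle>\<close> (lemma \<open>not_fg_intersection\<close>). It remains to choose \<open>w\<close> and \<open>f\<close>
  so that this never happens.

  The choice is a ping-pong argument that treats surjective and proper \<open>\<phi>\<close> alike. As \<open>\<phi>\<close> is
  injective, only finitely many elements have short images, and therefore the first letter of
  \<open>\<phi>(x)\<close> depends only on a sufficiently long prefix of \<open>x\<close>
  (lemma \<open>first_letter_determined_by_prefix\<close>). Take basis elements \<open>a \<noteq> b\<close>, a large \<open>n\<close>, and a letter \<open>R\<close>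
  that differs from \<open>a\<close> and from the first letters of \<open>\<phi>(a\<^sup>n)\<close> and \<open>\<phi>(b\<^sup>n)\<close>; among the four letters
  \<open>a, a\<inverse>, b, b\<inverse>\<close> there is one. Let \<open>f = b\<^sup>n a b\<^sup>-\<^sup>n\<close> and \<open>w = a\<^sup>n R\<inverse>\<close>. Write \<open>U\<^sub>+\<close>, \<open>U\<^sub>-\<close>, \<open>V\<close> for the sets
  of reduced words with prefix \<open>b\<^sup>n a\<close>, \<open>b\<^sup>n a\<inverse>\<close>, \<open>a\<^sup>n\<close>. If \<open>x\<close> and \<open>x\<inverse>\<close> lie in \<open>U\<^sub>+ \<union> U\<^sub>- \<union> V\<close>, then
  \<open>\<phi>(x)\<close> neither starts with \<open>R\<close> nor ends with \<open>R\<inverse>\<close>, hence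
  \<open>\<psi>(x) = a\<^sup>n R\<inverse> \<phi>(x) R a\<^sup>-\<^sup>n\<close> moves everything outside \<open>V\<close> into \<open>V\<close>. By induction every nontrivial
  element of \<open>B\<^sub>k = \<langle>f, \<dots>, \<psi>\<^sup>k\<^sup>-\<^sup>1(f)\<rangle>\<close> lies in \<open>U\<^sub>+ \<union> U\<^sub>- \<union> V\<close>, and \<open>\<langle>f\<rangle>\<close> and \<open>\<psi>(B\<^sub>k)\<close> generate their
  free product. In a free product \<open>\<langle>f\<rangle> * C\<close> the subgroup generated by \<open>f\<close> and some \<open>C' \<le> C\<close> meets \<open>C\<close>
  in \<open>C'\<close> only; so \<open>\<psi>\<^sup>k\<^sup>+\<^sup>1(f) \<in> B\<^sub>k\<^sub>+\<^sub>1 = \<langle>f, \<psi>(B\<^sub>k)\<rangle>\<close> would give \<open>\<psi>\<^sup>k(f) \<in> B\<^sub>k\<close>, and descending in \<open>k\<close>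
  ends in \<open>f = 1\<close> (lemma \<open>reduced_words_independent_orbit\<close>).

  To transfer this to \<open>G\<close> one needs that \<open>F\<close> embeds in \<open>G\<close>. This is proved by an action of \<open>G\<close> in which
  \<open>F\<close> acts freely (lemma \<open>inj_base\<close>).
\<close>

section \<open>Free groups as groups of reduced words\<close>

definition neg :: "'b \<times> bool \<Rightarrow> 'b \<times> bool" where
  "neg l = (fst l, \<not> snd l)"

lemma neg_neg [simp]: "neg (neg l) = l"
  by (simp add: neg_def)

lemma neg_eq_iff: "neg l = m \<longleftrightarrow> l = neg m"
  by (metis neg_neg)

abbreviation reduced :: "'b word \<Rightarrow> bool" where
  "reduced \<equiv> successively (\<lambda>l m. m \<noteq> neg l)"

fun cancel_cons :: "'b \<times> bool \<Rightarrow> 'b word \<Rightarrow> 'b word" where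
  "cancel_cons l [] = [l]"
| "cancel_cons l (m # w) = (if m = neg l then w else l # m # w)"

definition reduce :: "'b word \<Rightarrow> 'b word" where
  "reduce w = foldr cancel_cons w []"

lemma reduced_cancel_cons: "reduced w \<Longrightarrow> reduced (cancel_cons l w)"
  by (cases w) (auto simp: successively_Cons)

lemma reduced_reduce [simp]: "reduced (reduce w)"
  by (induction w) (auto simp: reduce_def reduced_cancel_cons)

lemma reduce_Nil [simp]: "reduce [] = []"
  by (simp add: reduce_def)

lemma reduce_Cons: "reduce (l # w) = cancel_cons l (reduce w)"
  by (simp add: reduce_def)

lemma reduce_reduced: "reduced w \<Longrightarrow> reduce w = w"
proof (induction w)
  case (Cons l w)
  then show ?case by (cases w) (auto simp: reduce_Cons)
qed simp

text \<open>
  Left multiplication by a letter is invertible on reduced words. That the value of a word under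
  \<open>reduce\<close> does not depend on where cancellations are carried out rests on this fact.
\<close>

lemma cancel_cons_neg: "reduced w \<Longrightarrow> cancel_cons l (cancel_cons (neg l) w) = w"
proof (cases w)
  case (Cons m v)
  assume "reduced w"
  then show ?thesis by (cases v) (auto simp: Cons)
qed simp

lemma foldr_cancel_cons_cancel_cons:
  "reduced x \<Longrightarrow> foldr cancel_cons (cancel_cons l u) x = cancel_cons l (foldr cancel_cons u x)"
proof (cases u)
  case (Cons m v)
  assume x: "reduced x"
  have "reduced (foldr cancel_cons v x)"
    by (induction v) (auto simp: x reduced_cancel_cons)
  then show ?thesis by (auto simp: Cons cancel_cons_neg)
qed simp

lemma reduce_append_right: "reduce (u @ reduce v) = reduce (u @ v)"
  by (metis foldr_append reduce_def reduce_reduced reduced_reduce)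

lemma reduce_append_left: "reduce (reduce u @ v) = reduce (u @ v)"
proof -
  have "foldr cancel_cons (reduce u) x = foldr cancel_cons u x" if "reduced x" for x
    by (induction u) (auto simp: reduce_Cons foldr_cancel_cons_cancel_cons that)
  from this[of "reduce v"] show ?thesis
    using reduced_reduce[of v] by (simp add: reduce_def)
qed

lemma reduce_cancel: "reduce (u @ l # neg l # v) = reduce (u @ v)"
proof -
  have "reduce (l # neg l # v) = reduce v"
    by (simp add: reduce_Cons cancel_cons_neg)
  then show ?thesis by (metis reduce_append_right)
qed

lemma set_cancel_cons: "set (cancel_cons l w) \<subseteq> insert l (set w)"
  by (cases w) auto

lemma set_reduce: "set (reduce w) \<subseteq> set w"
proof (induction w)
  case (Cons l w)
  then show ?case using set_cancel_cons[of l "reduce w"] by (auto simp: reduce_Cons)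
qed simp

lemma words_iff: "w \<in> words S \<longleftrightarrow> set w \<subseteq> S \<times> UNIV"
  by (auto simp: words_def)

lemma words_Cons [simp]: "l # w \<in> words S \<longleftrightarrow> fst l \<in> S \<and> w \<in> words S"
  by (cases l) (simp add: words_iff)

lemma fst_neg [simp]: "fst (neg l) = fst l"
  by (simp add: neg_def)

lemma reduce_in_words [simp]: "w \<in> words S \<Longrightarrow> reduce w \<in> words S"
  using set_reduce[of w] by (auto simp: words_iff)

text \<open>
  Each letter of \<open>v\<close> cancels at most one letter of the longer word \<open>u\<close>, so the first letter of \<open>u\<close> survives.
\<close>

lemma hd_reduce_append:
  "reduced u \<Longrightarrow> length v < length u \<Longrightarrow> reduce (u @ v) \<noteq> [] \<and> hd (reduce (u @ v)) = hd u"
proof (induction v arbitrary: u)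
  case Nil
  then show ?case by (simp add: reduce_reduced)
next
  case (Cons l v)
  show ?case
  proof (cases "last u = neg l")
    case True
    then obtain u' where u: "u = u' @ [neg l]"
      by (metis Cons.prems(2) append_butlast_last_id length_0_conv not_less_zero)
    have "reduce (u @ l # v) = reduce (u' @ v)"
      using reduce_cancel[of u' "neg l" v] by (simp add: u)
    moreover have "u' \<noteq> []" "reduced u'" "length v < length u'"
      using Cons.prems by (auto simp: u successively_append_iff)
    ultimately show ?thesis using Cons.IH[of u'] by (simp add: u)
  next
    case False
    then have "reduced (u @ [l])"
      using Cons.prems by (auto simp: successively_append_iff neg_eq_iff)
    moreover have "u \<noteq> []" using Cons.prems by auto
    ultimately show ?thesis using Cons.IH[of "u @ [l]"] Cons.prems by simp
  qed
qed

definition word_inv :: "'b word \<Rightarrow> 'b word" where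
  "word_inv w = rev (map neg w)"

lemma reduced_word_inv: "reduced (word_inv w) \<longleftrightarrow> reduced w"
  unfolding word_inv_def successively_rev successively_map
  by (intro successively_cong) (auto simp: neg_eq_iff)

lemma reduce_word_inv: "reduce (word_inv w @ w) = []"
proof (induction w)
  case (Cons l w)
  have "word_inv (l # w) @ l # w = word_inv w @ neg l # neg (neg l) # w"
    by (simp add: word_inv_def)
  then show ?case using Cons by (simp only: reduce_cancel)
qed (simp add: word_inv_def)

lemma word_inv_in_words [simp]: "w \<in> words S \<Longrightarrow> word_inv w \<in> words S"
  by (force simp: word_inv_def words_iff neg_def)

definition reduced_words :: "'b set \<Rightarrow> 'b word monoid" where
  "reduced_words S = \<lparr>carrier = {w \<in> words S. reduced w}, mult = (\<lambda>u v. reduce (u @ v)), one = []\<rparr>"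

lemma carrier_reduced_words: "carrier (reduced_words S) = {w \<in> words S. reduced w}"
  and mult_reduced_words: "u \<otimes>\<^bsub>reduced_words S\<^esub> v = reduce (u @ v)"
  and one_reduced_words: "\<one>\<^bsub>reduced_words S\<^esub> = []"
  by (simp_all add: reduced_words_def)

lemmas reduced_words_simps = carrier_reduced_words mult_reduced_words one_reduced_words

lemma group_reduced_words: "group (reduced_words S)"
proof (rule groupI, goal_cases)
  case (5 w)
  then show ?case
    by (intro bexI[of _ "word_inv w"]) (auto simp: reduced_words_simps reduce_word_inv reduced_word_inv)
qed (auto simp: reduced_words_simps reduce_append_left reduce_append_right reduce_reduced)

lemma inv_reduced_words:
  assumes "w \<in> carrier (reduced_words S)"
  shows "inv\<^bsub>reduced_words S\<^esub> w = word_inv w"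
  using assms
  by (intro group.inv_equality[OF group_reduced_words])
     (auto simp: reduced_words_simps reduce_word_inv reduced_word_inv)

lemma pres_rel_reduce: "w \<in> words S \<Longrightarrow> (w, reduce w) \<in> pres_rel S R"
proof (induction w)
  case (Cons l w)
  have w: "w \<in> words S" and l: "[l] \<in> words S" and l': "fst l \<in> S"
    using Cons.prems by (auto simp: words_iff)
  have *: "(l # w, l # reduce w) \<in> pres_rel S R"
    using pres_rel_append_context[OF Cons.IH[OF w] l, of "[]"] by simp
  have rw: "reduce w \<in> words S" using w by simp
  show ?case
  proof (cases "reduce w")
    case Nil
    then show ?thesis using * by (simp add: reduce_Cons)
  next
    case (Cons m v)
    have "(l # neg l # v, v) \<in> pres_rel S R"
      using pres_rel.cancel[of "[]" S v "fst l" "snd l" R] rw Cons l'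
      by (auto simp: neg_def words_iff)
    then show ?thesis using * by (auto simp: Cons reduce_Cons intro: pres_rel.trans)
  qed
qed (simp add: pres_rel.refl)

lemma pres_rel_imp_reduce_eq: "(u, v) \<in> pres_rel S {} \<Longrightarrow> reduce u = reduce v"
proof (induction rule: pres_rel.induct)
  case (cancel u v x b)
  then show ?case using reduce_cancel[of u "(x, b)" v] by (simp add: neg_def)
qed auto

text \<open>
  Every class contains exactly one reduced word: the relations lead from any word to its reduction,
  and the reduction is constant on classes.
\<close>

lemma iso_reduced_words_free_group:
  "(\<lambda>w. pres_rel S {} `` {w}) \<in> iso (reduced_words S) (free_group S)"
proof (rule isoI)
  let ?c = "\<lambda>w. pres_rel S {} `` {w}"
  have cls: "?c (reduce w) = ?c w" if "w \<in> words S" for w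
    using equiv_class_eq[OF equiv_pres_rel pres_rel_reduce[OF that]] by simp
  have car: "carrier (free_group S) = ?c ` words S"
    by (auto simp: free_group_def presented_group_def quotient_def)
  have car': "?c w \<in> carrier (presented_group S {})" if "w \<in> words S" for w
    using that car by (auto simp: free_group_def)
  show "?c \<in> hom (reduced_words S) (free_group S)"
    by (rule homI) (auto simp: car' reduced_words_simps free_group_def presented_group_mult cls)
  have "inj_on ?c (carrier (reduced_words S))"
  proof (rule inj_onI)
    fix u v assume uv: "u \<in> carrier (reduced_words S)" "v \<in> carrier (reduced_words S)" "?c u = ?c v"
    then have "(u, v) \<in> pres_rel S {}"
      using eq_equiv_class[OF _ equiv_pres_rel] by (auto simp: reduced_words_simps)
    then show "u = v"
      using uv pres_rel_imp_reduce_eq[of u v S] by (auto simp: reduced_words_simps reduce_reduced)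
  qed
  moreover have "?c ` carrier (reduced_words S) = carrier (free_group S)"
  proof -
    have "?c w \<in> ?c ` carrier (reduced_words S)" if "w \<in> words S" for w
      using that by (subst cls[OF that, symmetric]) (rule imageI, simp add: reduced_words_simps)
    then show ?thesis by (auto simp: car) (auto simp: reduced_words_simps)
  qed
  ultimately show "bij_betw ?c (carrier (reduced_words S)) (carrier (free_group S))"
    by (simp add: bij_betw_def)
qed

lemma generate_letters:
  "generate (reduced_words S) ((\<lambda>l. [l]) ` (S \<times> UNIV)) = carrier (reduced_words S)"
proof -
  interpret group "reduced_words S" by (rule group_reduced_words)
  let ?L = "(\<lambda>l. [l]) ` (S \<times> UNIV)"
  have L: "?L \<subseteq> carrier (reduced_words S)"
    by (auto simp: reduced_words_simps words_iff)
  have "w \<in> generate (reduced_words S) ?L" if "w \<in> words S" "reduced w" for w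
    using that
  proof (induction w)
    case Nil
    then show ?case using generate.one[of "reduced_words S"] by (simp add: one_reduced_words)
  next
    case (Cons l w)
    then have "[l] \<in> generate (reduced_words S) ?L"
      by (intro generate.incl) (auto simp: words_iff)
    moreover have "w \<in> generate (reduced_words S) ?L"
      using Cons by (auto simp: words_iff successively_Cons)
    ultimately have "[l] \<otimes>\<^bsub>reduced_words S\<^esub> w \<in> generate (reduced_words S) ?L"
      by (rule generate.eng)
    then show ?case using Cons.prems by (simp add: mult_reduced_words reduce_reduced)
  qed
  then show ?thesis
    using generate_incl[OF L] by (auto simp: carrier_reduced_words)
qed

section \<open>Ping-pong for a cyclic group and a subgroup\<close>

text \<open>
  The alternating products of nontrivial powers of \<open>f\<close> and nontrivial elements of \<open>C\<close> that begin
  with a power of \<open>f\<close>, built one letter \<open>f\<^sup>\<plusminus>\<^sup>1\<close> at a time. The index \<open>s\<close> is the sign of the leading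
  power; it forbids \<open>f\<close> to be put directly in front of its inverse. The last factor from \<open>C\<close> may be
  trivial.
\<close>

inductive normal_form :: "('a, 'm) monoid_scheme \<Rightarrow> 'a \<Rightarrow> 'a set \<Rightarrow> bool \<Rightarrow> 'a \<Rightarrow> bool"
  for G :: "('a, 'm) monoid_scheme" (structure) and f :: 'a and C :: "'a set" where
  last: "c \<in> C \<Longrightarrow> normal_form G f C s ((if s then f else inv f) \<otimes> c)"
| more: "normal_form G f C s h \<Longrightarrow> normal_form G f C s ((if s then f else inv f) \<otimes> h)"
| turn: "normal_form G f C s' h \<Longrightarrow> c \<in> C \<Longrightarrow> c \<noteq> \<one> \<Longrightarrow>
    normal_form G f C s ((if s then f else inv f) \<otimes> (c \<otimes> h))"

text \<open>
  Used with \<open>x = \<one>\<close> to put every element of a generated subgroup into an explicit form: the set \<open>M\<close> of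
  these forms has to absorb one generator at a time on the left.
\<close>

lemma (in group) generate_left_mult_induct:
  assumes "h \<in> generate G A" "A \<subseteq> carrier G" "M \<subseteq> carrier G" "x \<in> M"
    and "\<And>a y. a \<in> A \<Longrightarrow> y \<in> M \<Longrightarrow> a \<otimes> y \<in> M \<and> inv a \<otimes> y \<in> M"
  shows "h \<otimes> x \<in> M"
  using assms(1,4)
proof (induction arbitrary: x)
  case (eng h1 h2)
  then show ?case
    using m_assoc generate_in_carrier[OF assms(2)] assms(3) by (metis subsetD)
qed (use assms in auto)

lemma (in group) normal_form_carrier:
  assumes "f \<in> carrier G" "C \<subseteq> carrier G" "normal_form G f C s h"
  shows "h \<in> carrier G"
  using assms(3) by induction (use assms(1,2) in auto)

text \<open>
  Putting one more letter \<open>f\<^sup>\<plusminus>\<^sup>1\<close> in front of \<open>c \<otimes> k\<close> lengthens the alternating product, except when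
  \<open>c\<close> is trivial and \<open>k\<close> starts with the inverse letter; then it cancels that letter.
\<close>

lemma (in group) generate_normal_form:
  assumes f: "f \<in> carrier G" and C: "subgroup C G" and h: "h \<in> generate G (insert f C)"
  shows "h \<in> C \<or> (\<exists>c s k. c \<in> C \<and> normal_form G f C s k \<and> h = c \<otimes> k)"
proof -
  interpret C: subgroup C G by (rule C)
  define M where "M = C \<union> {c \<otimes> k | c s k. c \<in> C \<and> normal_form G f C s k}"
  have nf: "k \<in> carrier G" if "normal_form G f C s k" for s k
    using normal_form_carrier[OF f C.subset that] .
  have nfM: "k \<in> M" if "normal_form G f C s k" for s k
  proof -
    have "k = \<one> \<otimes> k" using nf[OF that] by simp
    then show ?thesis using that C.one_closed unfolding M_def by blast
  qed
  have CM: "c \<otimes> x \<in> M" if "c \<in> C" "x \<in> M" for c x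
  proof -
    consider "x \<in> C" | c' s k where "c' \<in> C" "normal_form G f C s k" "x = c' \<otimes> k"
      using \<open>x \<in> M\<close> by (auto simp: M_def)
    then show ?thesis
    proof cases
      case 1
      then show ?thesis using \<open>c \<in> C\<close> by (simp add: M_def)
    next
      case 2
      then have "c \<otimes> x = (c \<otimes> c') \<otimes> k" using \<open>c \<in> C\<close> nf[of s k] by (simp add: m_assoc)
      moreover have "c \<otimes> c' \<in> C" using 2 \<open>c \<in> C\<close> by simp
      ultimately show ?thesis using 2(2) unfolding M_def by blast
    qed
  qed
  have fM: "(if s then f else inv f) \<otimes> x \<in> M" if "x \<in> M" for s x
  proof -
    consider "x \<in> C" | c s' k where "c \<in> C" "normal_form G f C s' k" "x = c \<otimes> k"
      using \<open>x \<in> M\<close> by (auto simp: M_def)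
    then show ?thesis
    proof cases
      case 1
      then show ?thesis by (rule nfM[OF normal_form.last])
    next
      case 2
      show ?thesis
      proof (cases "c = \<one>")
        case False
        then show ?thesis using nfM[OF normal_form.turn[OF 2(2,1)], of s] by (simp add: 2(3))
      next
        case True
        then have x: "x = k" using 2 nf[of s' k] by simp
        show ?thesis
        proof (cases "s' = s")
          case True
          then show ?thesis using nfM[OF normal_form.more[OF 2(2)]] by (simp only: x)
        next
          case False
          have canc: "(if s then f else inv f) \<otimes> ((if s' then f else inv f) \<otimes> z) = z"
            if "z \<in> carrier G" for z
          proof -
            have "inv f \<otimes> (f \<otimes> z) = z" "f \<otimes> (inv f \<otimes> z) = z"
              using f that by (simp_all flip: m_assoc)
            then show ?thesis using False by (cases s; cases s') simp_all
          qed
          from 2(2) show ?thesis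
          proof cases
            case (last c')
            have "c' \<in> M" using last by (simp add: M_def)
            then show ?thesis using last canc by (simp add: x)
          next
            case (more k')
            then show ?thesis using canc[of k'] nf[of s' k'] nfM[of s' k'] by (simp add: x)
          next
            case (turn s'' k' c')
            have "c' \<otimes> k' \<in> M" using turn unfolding M_def by blast
            then show ?thesis using turn canc[of "c' \<otimes> k'"] nf[of s'' k'] by (simp add: x)
          qed
        qed
      qed
    qed
  qed
  have "h \<otimes> \<one> \<in> M"
  proof (rule generate_left_mult_induct[OF h])
    show "a \<otimes> y \<in> M \<and> inv a \<otimes> y \<in> M" if "a \<in> insert f C" "y \<in> M" for a y
      using that fM[of y True] fM[of y False] CM by auto
  qed (use f C.subset nf in \<open>auto simp: M_def\<close>)
  moreover have "h \<in> carrier G"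
    using h f C.subset by (intro generate_in_carrier[of "insert f C"]) auto
  ultimately show ?thesis by (auto simp: M_def)
qed

text \<open>
  The dynamics of a free product \<open>\<langle>f\<rangle> * C\<close>, stated for the action of the group on itself by left
  multiplication: \<open>U True\<close> and \<open>U False\<close> are the targets of the positive and the negative powers of \<open>f\<close>,
  and \<open>V\<close> is the target of the nontrivial elements of \<open>C\<close>. With the identity as base point, an element
  lies in the set into which it moves that point.
\<close>

locale ping_pong = group +
  fixes f :: 'a and C :: "'a set" and U :: "bool \<Rightarrow> 'a set" and V :: "'a set"
  assumes f: "f \<in> carrier G" and C: "subgroup C G"
    and U_disjoint: "U True \<inter> U False = {}" and UV_disjoint: "U s \<inter> V = {}"
    and one_notin: "\<one> \<notin> U s" "\<one> \<notin> V"
    and f_move: "x \<in> carrier G \<Longrightarrow> x \<notin> U (\<not> s) \<Longrightarrow> (if s then f else inv f) \<otimes> x \<in> U s"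
    and C_move: "c \<in> C \<Longrightarrow> c \<noteq> \<one> \<Longrightarrow> x \<in> carrier G \<Longrightarrow> x \<notin> V \<Longrightarrow> c \<otimes> x \<in> V"
begin

lemma C_subset_V: "c \<in> C \<Longrightarrow> c \<noteq> \<one> \<Longrightarrow> c \<in> V"
  using C_move[of c \<one>] one_notin subgroup.mem_carrier[OF C] by auto

lemma normal_form_in_U:
  assumes "C' \<subseteq> C" "normal_form G f C' s h"
  shows "h \<in> U s"
  using assms(2)
proof (induction rule: normal_form.induct)
  have C': "C' \<subseteq> carrier G" using assms subgroup.subset[OF C] by auto
  case (last c s)
  then have "c \<notin> U (\<not> s)"
    using C_subset_V[of c] UV_disjoint[of "\<not> s"] one_notin assms(1) by (cases "c = \<one>") auto
  then show ?case using last C' by (intro f_move) auto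
next
  have C': "C' \<subseteq> carrier G" using assms subgroup.subset[OF C] by auto
  case (more s h)
  then show ?case
    using U_disjoint normal_form_carrier[OF f C'] by (intro f_move) (cases s; auto)+
next
  have C': "C' \<subseteq> carrier G" using assms subgroup.subset[OF C] by auto
  case (turn s' h c s)
  then have h: "h \<in> carrier G" "c \<in> carrier G" using normal_form_carrier[OF f C'] C' by auto
  then have "c \<otimes> h \<in> V"
    using turn UV_disjoint[of s'] assms(1) by (intro C_move) auto
  then show ?case using h UV_disjoint[of "\<not> s"] by (intro f_move) auto
qed

lemma generate_subset_UV:
  assumes "h \<in> generate G (insert f C)" "h \<noteq> \<one>"
  shows "h \<in> U True \<union> U False \<union> V"
proof -
  consider "h \<in> C" | c s k where "c \<in> C" "normal_form G f C s k" "h = c \<otimes> k"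
    using generate_normal_form[OF f C assms(1)] by blast
  then show ?thesis
  proof cases
    case 1
    then show ?thesis using C_subset_V assms(2) by auto
  next
    case 2
    have k: "k \<in> carrier G" "k \<in> U s"
      using 2 normal_form_in_U normal_form_carrier[OF f subgroup.subset[OF C]] by auto
    show ?thesis
    proof (cases "c = \<one>")
      case True
      then show ?thesis using 2 k by (cases s) auto
    next
      case False
      then have "c \<otimes> k \<in> V" using k 2 UV_disjoint[of s] by (intro C_move) auto
      then show ?thesis using 2 by auto
    qed
  qed
qed

text \<open>
  If \<open>c \<otimes> k\<close> with \<open>c \<in> C'\<close> and \<open>k\<close> a normal form were in \<open>C\<close>, then \<open>k\<close> would be in \<open>C\<close> as well, hence
  be trivial or in \<open>V\<close>; but normal forms lie in \<open>U True\<close> or \<open>U False\<close>.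
\<close>

lemma generate_Int_subset:
  assumes C': "subgroup C' G" "C' \<subseteq> C"
  shows "generate G (insert f C') \<inter> C \<subseteq> C'"
proof
  fix h assume h: "h \<in> generate G (insert f C') \<inter> C"
  interpret C: subgroup C G by (rule C)
  show "h \<in> C'"
  proof (rule ccontr)
    assume "h \<notin> C'"
    then obtain c s k where ck: "c \<in> C'" "normal_form G f C' s k" "h = c \<otimes> k"
      using h generate_normal_form[OF f C'(1)] by blast
    have k: "k \<in> carrier G" "k \<in> U s"
      using ck normal_form_in_U[OF C'(2)] normal_form_carrier[OF f subgroup.subset[OF C'(1)]] by auto
    have c: "c \<in> C" using ck C'(2) by blast
    then have "k = inv c \<otimes> h" using ck(3) k(1) by (simp flip: m_assoc)
    then have "k \<in> C" using c h by (metis C.m_closed C.m_inv_closed IntD2)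
    then show False
      using k C_subset_V[of k] one_notin UV_disjoint[of s] by auto
  qed
qed

end

section \<open>Intersections that are not finitely generated\<close>

text \<open>
  The map \<open>\<chi>\<close> is a homomorphism to \<open>\<int>\<close> that vanishes on \<open>K\<close> and not on \<open>y\<close>. Since every element of
  \<open>\<langle>e, y\<rangle>\<close> is a product of conjugates \<open>c i\<close> and a power of \<open>y\<close>, it forces \<open>\<langle>e, y\<rangle> \<inter> K\<close> into the
  subgroup generated by the \<open>c i\<close>.
\<close>

lemma (in group) not_fg_intersection:
  fixes \<chi> :: "'a \<Rightarrow> int" and y e :: 'a
  defines "c \<equiv> \<lambda>i::int. y [^] i \<otimes> e \<otimes> y [^] (- i)"
  assumes \<chi>: "\<And>g h. g \<in> carrier G \<Longrightarrow> h \<in> carrier G \<Longrightarrow> \<chi> (g \<otimes> h) = \<chi> g + \<chi> h"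
    and K: "subgroup K G" "\<And>k. k \<in> K \<Longrightarrow> \<chi> k = 0"
    and y: "y \<in> carrier G" "\<chi> y \<noteq> 0" and e: "e \<in> carrier G"
    and conj_in_K: "\<And>i. i \<ge> 0 \<Longrightarrow> c i \<in> K"
    and independent: "\<And>k. c (int k) \<notin> generate G ((\<lambda>i. c (int i)) ` {..<k})"
  shows "\<not> fg_subgroup (generate G {e, y} \<inter> K) G"
proof
  interpret K: subgroup K G by (rule K)
  define N where "N = generate G (range c)"
  have c_carrier [simp]: "c i \<in> carrier G" for i using y e by (simp add: c_def)
  have c_conj: "y [^] m \<otimes> c i \<otimes> y [^] (- m) = c (m + i)" for m i :: int
    using y e by (simp add: c_def int_pow_mult m_assoc int_pow_neg inv_mult_group)
  have c_0: "c 0 = e" using e by (simp add: c_def)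
  have e_K: "e \<in> K" using conj_in_K[of 0] by (simp add: c_0)
  have \<chi>_one: "\<chi> \<one> = 0" using K by auto
  have \<chi>_inv: "\<chi> (inv g) = - \<chi> g" if "g \<in> carrier G" for g
    using \<chi>[of g "inv g"] that \<chi>_one by simp
  have \<chi>_pow_nat: "\<chi> (y [^] n) = int n * \<chi> y" for n :: nat
    by (induction n) (auto simp: \<chi>_one \<chi> y algebra_simps)
  have \<chi>_pow: "\<chi> (y [^] i) = i * \<chi> y" for i :: int
    by (cases i rule: int_cases2) (auto simp: int_pow_int int_pow_neg \<chi>_inv \<chi>_pow_nat y)
  have gen_conj: "y [^] m \<otimes> n \<otimes> y [^] (- m) \<in> generate G (c ` (+) m ` I)"
    if "n \<in> generate G (c ` I)" for n m and I :: "int set"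
  proof -
    interpret conj: group_hom G G "\<lambda>x. y [^] m \<otimes> x \<otimes> y [^] (- m)"
      by unfold_locales (auto intro!: homI simp: y m_assoc int_pow_neg inv_solve_left)
    have "generate G ((\<lambda>x. y [^] m \<otimes> x \<otimes> y [^] (- m)) ` c ` I) =
        (\<lambda>x. y [^] m \<otimes> x \<otimes> y [^] (- m)) ` generate G (c ` I)"
      by (rule conj.generate_img) auto
    then show ?thesis using that by (auto simp: image_image c_conj)
  qed
  have N_carrier: "N \<subseteq> carrier G" unfolding N_def by (rule generate_incl) auto
  have N_group: "subgroup N G" unfolding N_def by (rule generate_is_subgroup) auto
  have e_N: "e \<in> N" "inv e \<in> N"
    using generate.incl[OF rangeI[of c 0]] generate.inv[OF rangeI[of c 0]]
    by (simp_all add: N_def c_0)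
  have H: "\<exists>n\<in>N. \<exists>i. h = n \<otimes> y [^] (i::int)" if h: "h \<in> generate G {e, y}" for h
  proof -
    define M where "M = {n \<otimes> y [^] i | n i::int. n \<in> N}"
    have NM: "g \<otimes> x \<in> M" if "g \<in> N" "x \<in> M" for g x
    proof -
      obtain n i where x: "n \<in> N" "x = n \<otimes> y [^] (i::int)" using \<open>x \<in> M\<close> by (auto simp: M_def)
      have "g \<in> carrier G" "n \<in> carrier G" using that x N_carrier by auto
      then have "g \<otimes> x = (g \<otimes> n) \<otimes> y [^] i" using x y by (simp add: m_assoc)
      then show ?thesis using that x subgroup.m_closed[OF N_group] by (auto simp: M_def)
    qed
    have yM: "y [^] m \<otimes> x \<in> M" if "x \<in> M" for m :: int and x
    proof -
      obtain n i where x: "n \<in> N" "x = n \<otimes> y [^] (i::int)" using \<open>x \<in> M\<close> by (auto simp: M_def)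
      have "n \<in> carrier G" using x N_carrier by auto
      then have "y [^] m \<otimes> x = (y [^] m \<otimes> n \<otimes> y [^] (- m)) \<otimes> y [^] (m + i)"
        using x y by (simp add: m_assoc flip: int_pow_mult)
      moreover have "y [^] m \<otimes> n \<otimes> y [^] (- m) \<in> N"
        using gen_conj[of n UNIV m] x mono_generate[of "c ` (+) m ` UNIV" "range c"]
        by (auto simp: N_def)
      ultimately show ?thesis by (auto simp: M_def)
    qed
    have "h \<otimes> \<one> \<in> M"
    proof (rule generate_left_mult_induct[OF h])
      show "a \<otimes> x \<in> M \<and> inv a \<otimes> x \<in> M" if "a \<in> {e, y}" "x \<in> M" for a x
        using that NM e_N yM[of x 1] yM[of x "-1"] y by (auto simp: int_pow_neg)
      show "\<one> \<in> M"
        using subgroup.one_closed[OF N_group] by (force simp: M_def intro: exI[of _ "0::int"])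
    qed (use y e N_carrier in \<open>auto simp: M_def\<close>)
    then show ?thesis using generate_in_carrier[OF _ h] y e by (auto simp: M_def)
  qed
  have \<chi>_N: "\<chi> n = 0" if "n \<in> N" for n
    using that unfolding N_def
  proof induction
    case (eng h1 h2)
    then have "h1 \<in> carrier G" "h2 \<in> carrier G" using N_carrier by (auto simp: N_def)
    then show ?case using eng by (simp add: \<chi>)
  next
    case (incl h)
    then show ?case using y e K(2)[OF e_K] by (auto simp: c_def \<chi> \<chi>_pow)
  next
    case (inv h)
    then show ?case using y e K(2)[OF e_K] by (auto simp: c_def \<chi> \<chi>_inv \<chi>_pow)
  qed (rule \<chi>_one)
  have HK_N: "h \<in> N" if h: "h \<in> generate G {e, y}" "h \<in> K" for h
  proof -
    obtain n i where n: "n \<in> N" "h = n \<otimes> y [^] (i::int)" using H[OF h(1)] by blast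
    have "n \<in> carrier G" using n N_carrier by auto
    then have "i * \<chi> y = 0" using K(2)[OF \<open>h \<in> K\<close>] n y \<chi>_N by (simp add: \<chi> \<chi>_pow)
    then show ?thesis using n y \<open>n \<in> carrier G\<close> by simp
  qed
  have N_exhaust: "\<exists>m. h \<in> generate G (c ` {- int m..int m})" if "h \<in> N" for h
    using that unfolding N_def
  proof induction
    case one
    show ?case by (blast intro: generate.one)
  next
    case (incl h)
    then obtain i where "h = c i" by auto
    then show ?case by (intro exI[of _ "nat \<bar>i\<bar>"] generate.incl) (auto intro!: imageI)
  next
    case (inv h)
    then obtain i where "h = c i" by auto
    then show ?case by (intro exI[of _ "nat \<bar>i\<bar>"] generate.inv) (auto intro!: imageI)
  next
    case (eng h1 h2)
    then obtain m1 m2 where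
      m: "h1 \<in> generate G (c ` {- int m1..int m1})" "h2 \<in> generate G (c ` {- int m2..int m2})"
      by blast
    have "generate G (c ` {- int m1..int m1}) \<subseteq> generate G (c ` {- int (m1 + m2)..int (m1 + m2)})"
      "generate G (c ` {- int m2..int m2}) \<subseteq> generate G (c ` {- int (m1 + m2)..int (m1 + m2)})"
      by (intro mono_generate image_mono; force)+
    then show ?case using m by (blast intro: generate.eng)
  qed
  assume "fg_subgroup (generate G {e, y} \<inter> K) G"
  then obtain A where A: "finite A" "A \<subseteq> carrier G" "generate G {e, y} \<inter> K = generate G A"
    by (auto simp: fg_subgroup_def)
  have "A \<subseteq> N" using A(3) HK_N by (auto intro: generate.incl)
  with A(1) have "\<exists>m. A \<subseteq> generate G (c ` {- int m..int m})"
  proof induction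
    case (insert a A)
    then obtain m1 m2 where
      m: "A \<subseteq> generate G (c ` {- int m1..int m1})" "a \<in> generate G (c ` {- int m2..int m2})"
      using N_exhaust by blast
    have "generate G (c ` {- int m1..int m1}) \<subseteq> generate G (c ` {- int (m1 + m2)..int (m1 + m2)})"
      "generate G (c ` {- int m2..int m2}) \<subseteq> generate G (c ` {- int (m1 + m2)..int (m1 + m2)})"
      by (intro mono_generate image_mono; force)+
    then show ?case using m by blast
  qed auto
  \<comment> \<open>Finitely many generators use only the conjugates with index between \<open>-m\<close> and \<open>m\<close>.
    The next one, \<open>c (m + 1)\<close>, is in the intersection; conjugating by \<open>y\<^sup>m\<close> moves all these
    indices into the range \<open>0, \<dots>, 2m + 1\<close> and contradicts independence.\<close>
  then obtain m where m: "A \<subseteq> generate G (c ` {- int m..int m})" by blast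
  have "c (int m + 1) \<in> generate G {e, y}"
  proof -
    have sub: "subgroup (generate G {e, y}) G" using y e by (intro generate_is_subgroup) auto
    have "e \<in> generate G {e, y}" "y \<in> generate G {e, y}" by (auto intro: generate.incl)
    then show ?thesis
      unfolding c_def
      by (intro subgroup.m_closed[OF sub] subgroup_int_pow_closed[OF sub])
  qed
  then have "c (int m + 1) \<in> generate G A" using conj_in_K[of "int m + 1"] A(3) by auto
  also have "generate G A \<subseteq> generate G (c ` {- int m..int m})"
    using m by (intro generate_subgroup_incl generate_is_subgroup) auto
  finally have "y [^] int m \<otimes> c (int m + 1) \<otimes> y [^] (- int m)
      \<in> generate G (c ` (+) (int m) ` {- int m..int m})"
    by (rule gen_conj)
  moreover have "(+) (int m) ` {- int m..int m} = int ` {..<2 * m + 1}"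
  proof -
    have "(+) (int m) ` {- int m..int m} = {0..2 * int m}" by (simp add: image_add_atLeastAtMost)
    also have "\<dots> = int ` {..<2 * m + 1}"
      by (auto simp: image_iff intro!: bexI[of _ "nat _"])
    finally show ?thesis .
  qed
  moreover have "int m + (int m + 1) = int (2 * m + 1)" by simp
  ultimately have "c (int (2 * m + 1)) \<in> generate G (c ` int ` {..<2 * m + 1})"
    by (simp only: c_conj)
  then show False using independent[of "2 * m + 1"] by (simp only: image_image not_True_eq_False)
qed

section \<open>Endomorphisms with an independent orbit\<close>

text \<open>
  Let \<open>L\<close> bound the lengths of the images of letters. By injectivity only finitely many words have
  images of length at most \<open>L\<close>; let \<open>n\<close> exceed their lengths. Extending a word of length at least \<open>n\<close>
  letter by letter multiplies an image longer than \<open>L\<close> by one of length at most \<open>L\<close>, which never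
  reaches its first letter. This is the continuity of \<open>\<Phi>\<close> at the boundary of the Cayley tree.
\<close>

lemma first_letter_determined_by_prefix:
  assumes S: "finite S" and \<Phi>: "\<Phi> \<in> hom (reduced_words S) (reduced_words S)"
    and inj: "inj_on \<Phi> (carrier (reduced_words S))"
  shows "\<exists>n>0. \<forall>p v. length p \<ge> n \<longrightarrow> p @ v \<in> carrier (reduced_words S) \<longrightarrow>
    \<Phi> (p @ v) \<noteq> [] \<and> hd (\<Phi> (p @ v)) = hd (\<Phi> p)"
proof -
  let ?W = "carrier (reduced_words S)"
  have \<Phi>_W: "\<Phi> w \<in> ?W" if "w \<in> ?W" for w using \<Phi> that by (auto simp: hom_def)
  define L where "L = Max (insert 0 ((\<lambda>l. length (\<Phi> [l])) ` (S \<times> UNIV)))"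
  have L: "length (\<Phi> [l]) \<le> L" if "l \<in> S \<times> UNIV" for l
    unfolding L_def using S that by (intro Max_ge) auto
  define E where "E = {w \<in> ?W. length (\<Phi> w) \<le> L}"
  have "\<Phi> ` E \<subseteq> {w. set w \<subseteq> S \<times> UNIV \<and> length w \<le> L}"
    using \<Phi>_W by (auto simp: E_def carrier_reduced_words words_iff)
  then have "finite (\<Phi> ` E)"
    using finite_lists_length_le[of "S \<times> (UNIV :: bool set)" L] S by (auto intro: finite_subset)
  then have "finite E"
    by (rule finite_imageD) (auto intro: inj_on_subset[OF inj] simp: E_def)
  then have "finite (length ` E)" by simp
  then obtain n where n: "\<forall>k\<in>length ` E. k < n" by (auto simp: finite_nat_set_iff_bounded)
  have long: "length (\<Phi> w) > L" if "w \<in> ?W" "length w \<ge> n" for w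
    using n that by (force simp: E_def)
  have "\<Phi> (p @ v) \<noteq> [] \<and> hd (\<Phi> (p @ v)) = hd (\<Phi> p)"
    if "length p \<ge> n" "p @ v \<in> ?W" for p v
    using that
  proof (induction v rule: rev_induct)
    case Nil
    then show ?case using long[of p] by auto
  next
    case (snoc l v)
    let ?u = "p @ v"
    have u: "?u \<in> ?W" "[l] \<in> ?W" "l \<in> S \<times> UNIV"
      using snoc.prems by (auto simp: carrier_reduced_words words_iff successively_append_iff)
    have "p @ v @ [l] = ?u \<otimes>\<^bsub>reduced_words S\<^esub> [l]"
      using snoc.prems by (simp add: reduced_words_simps reduce_reduced)
    then have "\<Phi> (p @ v @ [l]) = reduce (\<Phi> ?u @ \<Phi> [l])"
      using u hom_mult[OF \<Phi>, of ?u "[l]"] by (simp add: mult_reduced_words)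
    moreover have "length (\<Phi> [l]) < length (\<Phi> ?u)"
      using L[OF u(3)] long[OF u(1)] snoc.prems by simp
    moreover have "reduced (\<Phi> ?u)" using \<Phi>_W[OF u(1)] by (simp add: carrier_reduced_words)
    ultimately show ?case
      using hd_reduce_append[of "\<Phi> ?u" "\<Phi> [l]"] snoc.IH snoc.prems(1) u(1) by simp
  qed
  then show ?thesis
    by (intro exI[of _ "Suc n"]) auto
qed

definition cylinder :: "'b set \<Rightarrow> 'b word \<Rightarrow> 'b word set" where
  "cylinder S p = {w \<in> carrier (reduced_words S). \<exists>v. w = p @ v}"

lemma reduced_replicate: "reduced (replicate n (x, b))"
  by (induction n) (auto simp: successively_Cons neg_def)

lemma mult_concat:
  "reduced (u @ v) \<Longrightarrow> u \<otimes>\<^bsub>reduced_words S\<^esub> v = u @ v"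
  by (simp add: mult_reduced_words reduce_reduced)

lemma mult_cylinder:
  assumes "p @ y \<in> carrier (reduced_words S)"
  shows "p \<otimes>\<^bsub>reduced_words S\<^esub> y \<in> cylinder S p"
  using assms mult_concat[of p y S] by (auto simp: cylinder_def carrier_reduced_words)

text \<open>
  Write \<open>x = g y\<close>. As \<open>x\<close> does not extend \<open>g l\<inverse>\<close>, the word \<open>y\<close> does not start with \<open>l\<inverse>\<close>, and \<open>g l y\<close> is
  reduced as it stands.
\<close>

lemma conjugate_letter_move:
  assumes g: "g @ [l] \<in> carrier (reduced_words S)" "g @ [neg l] \<in> carrier (reduced_words S)"
    and x: "x \<in> carrier (reduced_words S)" "x \<notin> cylinder S (g @ [neg l])"
  shows "g \<otimes>\<^bsub>reduced_words S\<^esub> [l] \<otimes>\<^bsub>reduced_words S\<^esub> inv\<^bsub>reduced_words S\<^esub> g \<otimes>\<^bsub>reduced_words S\<^esub> x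
    \<in> cylinder S (g @ [l])"
proof -
  interpret group "reduced_words S" by (rule group_reduced_words)
  define y where "y = inv\<^bsub>reduced_words S\<^esub> g \<otimes>\<^bsub>reduced_words S\<^esub> x"
  have W: "g \<in> carrier (reduced_words S)" "[l] \<in> carrier (reduced_words S)"
    using g by (auto simp: carrier_reduced_words successively_append_iff)
  have y: "y \<in> carrier (reduced_words S)" using W x by (simp add: y_def)
  have gy: "g \<otimes>\<^bsub>reduced_words S\<^esub> y = x" using W x by (simp add: y_def flip: m_assoc)
  have "y = [] \<or> hd y \<noteq> neg l"
  proof (rule ccontr)
    assume "\<not> (y = [] \<or> hd y \<noteq> neg l)"
    then obtain y' where y': "y = [neg l] @ y'" by (cases y) auto
    then have "(g @ [neg l]) @ y' \<in> carrier (reduced_words S)"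
      using g y by (auto simp: carrier_reduced_words successively_append_iff)
    moreover from this have "x = (g @ [neg l]) @ y'"
      using gy y' by (simp add: mult_concat carrier_reduced_words)
    ultimately show False using x(2) by (auto simp: cylinder_def)
  qed
  then have "(g @ [l]) @ y \<in> carrier (reduced_words S)"
    using g y by (auto simp: carrier_reduced_words successively_append_iff successively_Cons)
  then have "(g @ [l]) \<otimes>\<^bsub>reduced_words S\<^esub> y \<in> cylinder S (g @ [l])"
    by (rule mult_cylinder)
  moreover have "g \<otimes>\<^bsub>reduced_words S\<^esub> [l] = g @ [l]"
    using g by (intro mult_concat) (simp add: carrier_reduced_words)
  ultimately show ?thesis using W g(1) x by (simp add: y_def m_assoc)
qed

text \<open>
  Write \<open>x = p y\<close>. As \<open>x\<close> does not extend \<open>p\<close>, the word \<open>y\<close> starts with the inverse of the last letter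
  of \<open>p\<close>, and the hypotheses say that \<open>p r z r\<inverse> y\<close> is reduced as it stands.
\<close>

lemma conjugate_long_word_move:
  assumes w: "p @ [r] \<in> carrier (reduced_words S)" and p: "p \<noteq> []" "last p \<noteq> neg r"
    and z: "z \<in> carrier (reduced_words S)" "z \<noteq> []" "hd z \<noteq> neg r"
      "hd (inv\<^bsub>reduced_words S\<^esub> z) \<noteq> neg r"
    and x: "x \<in> carrier (reduced_words S)" "x \<notin> cylinder S p"
  shows "(p @ [r]) \<otimes>\<^bsub>reduced_words S\<^esub> z \<otimes>\<^bsub>reduced_words S\<^esub> inv\<^bsub>reduced_words S\<^esub> (p @ [r])
    \<otimes>\<^bsub>reduced_words S\<^esub> x \<in> cylinder S p"
proof -
  interpret group "reduced_words S" by (rule group_reduced_words)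
  define y where "y = inv\<^bsub>reduced_words S\<^esub> p \<otimes>\<^bsub>reduced_words S\<^esub> x"
  have W: "p \<in> carrier (reduced_words S)" "[r] \<in> carrier (reduced_words S)"
      "[neg r] \<in> carrier (reduced_words S)"
    using w by (auto simp: carrier_reduced_words successively_append_iff words_iff neg_def)
  have y: "y \<in> carrier (reduced_words S)" using W x by (simp add: y_def)
  have py: "p \<otimes>\<^bsub>reduced_words S\<^esub> y = x" using W x by (simp add: y_def flip: m_assoc)
  have hd_y: "y \<noteq> []" "hd y = neg (last p)"
  proof -
    have "p @ y \<notin> carrier (reduced_words S)"
      using mult_cylinder[of p y S] py x(2) by auto
    then show "y \<noteq> []" "hd y = neg (last p)"
      using W y by (auto simp: carrier_reduced_words successively_append_iff)
  qed
  have last_z: "last z \<noteq> r"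
    using z by (auto simp: inv_reduced_words word_inv_def hd_rev last_map hd_map)
  have full: "p @ [r] @ z @ [neg r] @ y \<in> carrier (reduced_words S)"
    using w W y z hd_y p(2) last_z
    by (auto simp: carrier_reduced_words successively_append_iff successively_Cons neg_eq_iff)
  have "inv\<^bsub>reduced_words S\<^esub> (p @ [r]) \<otimes>\<^bsub>reduced_words S\<^esub> x = [neg r] \<otimes>\<^bsub>reduced_words S\<^esub> y"
  proof -
    have "p @ [r] = p \<otimes>\<^bsub>reduced_words S\<^esub> [r]"
      using w by (intro mult_concat[symmetric]) (simp add: carrier_reduced_words)
    moreover have "inv\<^bsub>reduced_words S\<^esub> [r] = [neg r]"
      using W by (simp add: inv_reduced_words word_inv_def)
    ultimately show ?thesis using W x by (simp add: y_def inv_mult_group m_assoc)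
  qed
  then have "(p @ [r]) \<otimes>\<^bsub>reduced_words S\<^esub> z \<otimes>\<^bsub>reduced_words S\<^esub> inv\<^bsub>reduced_words S\<^esub> (p @ [r])
      \<otimes>\<^bsub>reduced_words S\<^esub> x
    = (p @ [r]) \<otimes>\<^bsub>reduced_words S\<^esub> (z \<otimes>\<^bsub>reduced_words S\<^esub> ([neg r] \<otimes>\<^bsub>reduced_words S\<^esub> y))"
    using w z x by (simp add: m_assoc)
  also have "\<dots> = p @ [r] @ z @ [neg r] @ y"
  proof -
    have r: "reduced ([neg r] @ y)" "reduced (z @ [neg r] @ y)" "reduced ((p @ [r]) @ z @ [neg r] @ y)"
      using full by (auto simp: carrier_reduced_words successively_append_iff successively_Cons)
    show ?thesis by (simp only: mult_concat[OF r(1)] mult_concat[OF r(2)] mult_concat[OF r(3)]) simp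
  qed
  finally show ?thesis using full by (auto simp: cylinder_def)
qed

text \<open>
  In the notation of the introduction, \<open>p = a\<^sup>n\<close>, \<open>g = b\<^sup>n\<close>, \<open>U True\<close> and \<open>U False\<close> are the words with prefix
  \<open>b\<^sup>n a\<close> and \<open>b\<^sup>n a\<inverse>\<close>, and \<open>V\<close> those with prefix \<open>a\<^sup>n\<close>. The ping-pong hypothesis for \<open>\<psi>(B\<^sub>k)\<close>
  needs \<open>B\<^sub>k\<close> to lie in these sets apart from the identity, and its conclusion says the same of
  \<open>B\<^sub>k\<^sub>+\<^sub>1\<close>; this drives the induction.
\<close>

lemma reduced_words_independent_orbit:
  assumes S: "finite S" "\<alpha> \<in> S" "\<beta> \<in> S" "\<alpha> \<noteq> \<beta>"
    and \<Phi>: "\<Phi> \<in> hom (reduced_words S) (reduced_words S)"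
    and inj: "inj_on \<Phi> (carrier (reduced_words S))"
  shows "\<exists>w\<in>carrier (reduced_words S). \<exists>f\<in>carrier (reduced_words S). \<forall>k.
    ((\<lambda>x. w \<otimes>\<^bsub>reduced_words S\<^esub> \<Phi> x \<otimes>\<^bsub>reduced_words S\<^esub> inv\<^bsub>reduced_words S\<^esub> w) ^^ k) f
    \<notin> generate (reduced_words S)
      ((\<lambda>i. ((\<lambda>x. w \<otimes>\<^bsub>reduced_words S\<^esub> \<Phi> x \<otimes>\<^bsub>reduced_words S\<^esub> inv\<^bsub>reduced_words S\<^esub> w) ^^ i) f) ` {..<k})"
proof -
  define W where "W = reduced_words S"
  interpret group W unfolding W_def by (rule group_reduced_words)
  interpret \<Phi>: group_hom W W \<Phi> using \<Phi> by unfold_locales (simp add: W_def)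
  obtain n where n: "n > 0" "\<And>p v. length p \<ge> n \<Longrightarrow> p @ v \<in> carrier W \<Longrightarrow>
      \<Phi> (p @ v) \<noteq> [] \<and> hd (\<Phi> (p @ v)) = hd (\<Phi> p)"
    using first_letter_determined_by_prefix[OF S(1) \<Phi> inj] unfolding W_def by blast
  define p where "p = replicate n (\<alpha>, True)"
  define g where "g = replicate n (\<beta>, True)"
  \<comment> \<open>At most three of the four letters over \<open>\<alpha>\<close> and \<open>\<beta>\<close> are excluded.\<close>
  obtain R where R: "R \<in> S \<times> UNIV" "R \<notin> {(\<alpha>, True), hd (\<Phi> p), hd (\<Phi> g)}"
  proof -
    let ?L = "{(\<alpha>, True), (\<alpha>, False), (\<beta>, True), (\<beta>, False)}"
    let ?T = "{(\<alpha>, True), hd (\<Phi> p), hd (\<Phi> g)}"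
    have "card ?L = 4" using S(4) by simp
    moreover have "card ?T \<le> 3" by (simp add: card_insert_if)
    ultimately have "\<not> ?L \<subseteq> ?T"
      using card_mono[of ?T ?L] by fastforce
    then show thesis using that S by blast
  qed
  define f where "f = g \<otimes>\<^bsub>W\<^esub> [(\<alpha>, True)] \<otimes>\<^bsub>W\<^esub> inv\<^bsub>W\<^esub> g"
  define w where "w = p @ [neg R]"
  define \<Psi> where "\<Psi> = (\<lambda>x. w \<otimes>\<^bsub>W\<^esub> \<Phi> x \<otimes>\<^bsub>W\<^esub> inv\<^bsub>W\<^esub> w)"
  define U where "U s = cylinder S (g @ [(\<alpha>, s)])" for s
  define V where "V = cylinder S p"
  have p: "p \<noteq> []" "last p = (\<alpha>, True)" "hd p = (\<alpha>, True)"
    using n by (auto simp: p_def hd_replicate)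
  have g: "g \<noteq> []" "last g = (\<beta>, True)" "hd g = (\<beta>, True)"
    using n by (auto simp: g_def hd_replicate)
  have pW: "p \<in> carrier W" and gW: "g \<in> carrier W"
    using S by (auto simp: p_def g_def W_def carrier_reduced_words words_iff reduced_replicate)
  have wW: "w \<in> carrier W"
    using pW R p
    by (auto simp: w_def W_def carrier_reduced_words words_iff successively_append_iff neg_def)
  have lW: "[(\<alpha>, s)] \<in> carrier W" for s
    using S by (auto simp: W_def carrier_reduced_words words_iff)
  have glW: "g @ [(\<alpha>, s)] \<in> carrier W" for s
    using gW g S
    by (auto simp: W_def carrier_reduced_words words_iff successively_append_iff neg_def)
  have fW: "f \<in> carrier W" using gW lW by (simp add: f_def)
  have f_sign: "(if s then f else inv\<^bsub>W\<^esub> f) = g \<otimes>\<^bsub>W\<^esub> [(\<alpha>, s)] \<otimes>\<^bsub>W\<^esub> inv\<^bsub>W\<^esub> g" for s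
  proof -
    have "inv\<^bsub>W\<^esub> [(\<alpha>, True)] = [(\<alpha>, False)]"
      using lW[of True] by (simp add: W_def inv_reduced_words word_inv_def neg_def)
    then show ?thesis using gW lW by (simp add: f_def inv_mult_group m_assoc)
  qed
  interpret \<Psi>: group_hom W W \<Psi>
    by unfold_locales (auto intro!: homI simp: \<Psi>_def wW m_assoc inv_solve_left)
  have inj_\<Psi>: "inj_on \<Psi> (carrier W)"
    using inj wW by (auto simp: \<Psi>_def inj_on_def W_def[symmetric])
  define B where "B k = generate W ((\<lambda>i. (\<Psi> ^^ i) f) ` {..<k})" for k :: nat
  have orbit: "(\<Psi> ^^ i) f \<in> carrier W" for i
    by (induction i) (auto simp: fW)
  have B_group: "subgroup (B k) W" for k
    unfolding B_def by (rule generate_is_subgroup) (auto simp: orbit)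
  have B_mono: "B k \<subseteq> B (Suc k)" for k
    unfolding B_def by (intro mono_generate image_mono) auto
  have \<Psi>B_group: "subgroup (\<Psi> ` B k) W" for k
    using B_group by (rule \<Psi>.subgroup_img_is_subgroup)
  have B_Suc: "B (Suc k) \<subseteq> generate W (insert f (\<Psi> ` B k))" for k
  proof -
    have "(\<Psi> ^^ i) f \<in> insert f (\<Psi> ` B k)" if "i < Suc k" for i
    proof (cases i)
      case (Suc j)
      then have "(\<Psi> ^^ j) f \<in> B k" using that by (auto simp: B_def intro: generate.incl)
      then show ?thesis by (simp add: Suc)
    qed simp
    then show ?thesis unfolding B_def[of "Suc k"] by (intro mono_generate) auto
  qed
  have hd_\<Phi>: "\<Phi> x \<noteq> [] \<and> hd (\<Phi> x) \<noteq> R" if "x \<in> U True \<union> U False \<union> V" for x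
  proof -
    have "\<exists>q v. q \<in> {p, g} \<and> x = q @ v \<and> x \<in> carrier W"
      using that by (auto simp: U_def V_def cylinder_def W_def)
    then show ?thesis using n(2) R by (auto simp: p_def g_def)
  qed
  have ping_pong: "ping_pong W f (\<Psi> ` B k) U V"
    if B: "\<And>x. x \<in> B k \<Longrightarrow> x \<noteq> [] \<Longrightarrow> x \<in> U True \<union> U False \<union> V" for k
  proof (intro ping_pong.intro ping_pong_axioms.intro)
    show "group W" by (rule is_group)
    show "f \<in> carrier W" by (rule fW)
    show "subgroup (\<Psi> ` B k) W" by (rule \<Psi>B_group)
    show "U True \<inter> U False = {}" by (auto simp: U_def cylinder_def)
    show "U s \<inter> V = {}" for s
      using p g S(4) by (auto simp: U_def V_def cylinder_def append_eq_append_conv2 dest: arg_cong[of _ _ hd])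
    show "\<one>\<^bsub>W\<^esub> \<notin> U s" "\<one>\<^bsub>W\<^esub> \<notin> V" for s
      using p by (auto simp: U_def V_def cylinder_def W_def one_reduced_words)
    show "(if s then f else inv\<^bsub>W\<^esub> f) \<otimes>\<^bsub>W\<^esub> x \<in> U s"
      if "x \<in> carrier W" "x \<notin> U (\<not> s)" for x s
      using conjugate_letter_move[of g "(\<alpha>, s)" S x] that glW
      by (simp add: f_sign U_def neg_def W_def)
    show "c \<otimes>\<^bsub>W\<^esub> x \<in> V" if c: "c \<in> \<Psi> ` B k" "c \<noteq> \<one>\<^bsub>W\<^esub>" and x: "x \<in> carrier W" "x \<notin> V" for c x
    proof -
      obtain b where b: "b \<in> B k" "c = \<Psi> b" using c by auto
      have bW: "b \<in> carrier W" using b subgroup.mem_carrier[OF B_group] by blast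
      have "b \<noteq> \<one>\<^bsub>W\<^esub>" using b c(2) by auto
      moreover from this have "inv\<^bsub>W\<^esub> b \<noteq> \<one>\<^bsub>W\<^esub>" using bW by simp
      moreover have "inv\<^bsub>W\<^esub> b \<in> B k" using b subgroup.m_inv_closed[OF B_group] by blast
      ultimately have "b \<in> U True \<union> U False \<union> V" "inv\<^bsub>W\<^esub> b \<in> U True \<union> U False \<union> V"
        using b B by (auto simp: W_def one_reduced_words)
      then have "\<Phi> b \<noteq> []" "hd (\<Phi> b) \<noteq> R" "hd (inv\<^bsub>W\<^esub> (\<Phi> b)) \<noteq> R"
        using hd_\<Phi>[of b] hd_\<Phi>[of "inv\<^bsub>W\<^esub> b"] bW by auto
      moreover have "(\<alpha>, True) \<noteq> R" using R by auto
      ultimately show ?thesis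
        using conjugate_long_word_move[of p "neg R" S "\<Phi> b" x] p R wW bW x \<Phi>.hom_closed[of b]
        by (simp add: b \<Psi>_def w_def V_def W_def)
    qed
  qed
  have B_UV: "\<forall>x\<in>B k. x \<noteq> [] \<longrightarrow> x \<in> U True \<union> U False \<union> V" for k
  proof (induction k)
    case 0
    have "B 0 = {\<one>\<^bsub>W\<^esub>}" by (simp add: B_def generate_empty)
    then show ?case by (simp add: W_def one_reduced_words)
  next
    case (Suc k)
    then interpret ping_pong W f "\<Psi> ` B k" U V by (intro ping_pong) auto
    show ?case using generate_subset_UV B_Suc by (auto simp: W_def one_reduced_words)
  qed
  have "(\<Psi> ^^ k) f \<notin> B k" for k
  proof (induction k)
    case 0
    have "f \<noteq> \<one>\<^bsub>W\<^esub>"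
    proof
      assume "f = \<one>\<^bsub>W\<^esub>"
      then have "g \<otimes>\<^bsub>W\<^esub> [(\<alpha>, True)] = \<one>\<^bsub>W\<^esub> \<otimes>\<^bsub>W\<^esub> g"
        using gW lW[of True] unfolding f_def by (intro inv_solve_right'[THEN iffD1]) auto
      then have "[(\<alpha>, True)] = \<one>\<^bsub>W\<^esub>" using gW lW[of True] by simp
      then show False by (simp add: W_def one_reduced_words)
    qed
    then show ?case by (simp add: B_def generate_empty)
  next
    case (Suc k)
    interpret ping_pong W f "\<Psi> ` B (Suc k)" U V using B_UV by (intro ping_pong) auto
    show ?case
    proof
      assume *: "(\<Psi> ^^ Suc k) f \<in> B (Suc k)"
      have "(\<Psi> ^^ k) f \<in> B (Suc k)" by (auto simp: B_def intro: generate.incl)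
      then have "(\<Psi> ^^ Suc k) f \<in> \<Psi> ` B k"
        using * B_Suc[of k] generate_Int_subset[OF \<Psi>B_group[of k]] B_mono[of k] by auto
      then have "(\<Psi> ^^ k) f \<in> B k"
        using inj_\<Psi> orbit[of k] subgroup.subset[OF B_group[of k]] by (auto dest: inj_onD)
      then show False using Suc by blast
    qed
  qed
  then show ?thesis
    using wW fW unfolding B_def \<Psi>_def W_def by blast
qed

section \<open>The presentation of the extension\<close>

fun stable_exponent :: "'a option word \<Rightarrow> int" where
  "stable_exponent [] = 0"
| "stable_exponent ((None, b) # w) = (if b then 1 else -1) + stable_exponent w"
| "stable_exponent ((Some f, b) # w) = stable_exponent w"

lemma stable_exponent_append [simp]:
  "stable_exponent (u @ v) = stable_exponent u + stable_exponent v"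
  by (induction u rule: stable_exponent.induct) auto

locale endomorphism_HNN = F: group F for F :: "('a, 'm) monoid_scheme" +
  fixes \<phi> :: "'a \<Rightarrow> 'a"
  assumes \<phi>: "\<phi> \<in> hom F F"
begin

sublocale \<phi>: group_hom F F \<phi>
  by unfold_locales (rule \<phi>)

definition gens :: "'a option set" where
  "gens = insert None (Some ` carrier F)"

definition rels :: "('a option word \<times> 'a option word) set" where
  "rels = {([(Some f, True), (Some g, True)], [(Some (f \<otimes>\<^bsub>F\<^esub> g), True)]) | f g.
      f \<in> carrier F \<and> g \<in> carrier F} \<union>
    {([(None, True), (Some f, True), (None, False)], [(Some (\<phi> f), True)]) | f. f \<in> carrier F}"

abbreviation "E \<equiv> ascending_HNN F \<phi>"

definition cls :: "'a option word \<Rightarrow> 'a option word set" where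
  "cls w = pres_rel gens rels `` {w}"

definition base :: "'a \<Rightarrow> 'a option word set" where
  "base f = cls [(Some f, True)]"

definition stable_letter :: "'a option word set" where
  "stable_letter = cls [(None, True)]"

lemma E_presented: "E = presented_group gens rels"
  by (simp add: ascending_HNN_def gens_def rels_def)

sublocale E: group E
  unfolding E_presented by (rule group_presented_group)

lemma carrier_E: "carrier E = cls ` words gens"
  by (auto simp: E_presented presented_group_def quotient_def cls_def)

lemma cls_closed [simp]: "w \<in> words gens \<Longrightarrow> cls w \<in> carrier E"
  by (simp add: carrier_E)

lemma cls_append: "u \<in> words gens \<Longrightarrow> v \<in> words gens \<Longrightarrow> cls u \<otimes>\<^bsub>E\<^esub> cls v = cls (u @ v)"
  unfolding E_presented cls_def by (rule presented_group_mult)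

lemma cls_eqI: "(u, v) \<in> pres_rel gens rels \<Longrightarrow> cls u = cls v"
  unfolding cls_def by (rule equiv_class_eq[OF equiv_pres_rel])

lemma cls_Nil: "cls [] = \<one>\<^bsub>E\<^esub>"
  by (simp add: E_presented presented_group_def cls_def)

lemma gens_iff [simp]: "None \<in> gens" "Some f \<in> gens \<longleftrightarrow> f \<in> carrier F"
  by (auto simp: gens_def)

lemma base_closed [simp]: "f \<in> carrier F \<Longrightarrow> base f \<in> carrier E"
  by (simp add: base_def)

lemma stable_closed [simp]: "stable_letter \<in> carrier E"
  by (simp add: stable_letter_def)

lemma cls_relation: "(r, s) \<in> rels \<Longrightarrow> r \<in> words gens \<Longrightarrow> s \<in> words gens \<Longrightarrow> cls r = cls s"
  using pres_rel.relation[of r s rels gens "[]" "[]"] by (intro cls_eqI) simp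

lemma base_hom: "base \<in> hom F E"
proof (rule homI)
  fix f g assume fg: "f \<in> carrier F" "g \<in> carrier F"
  then have "cls [(Some f, True), (Some g, True)] = cls [(Some (f \<otimes>\<^bsub>F\<^esub> g), True)]"
    by (intro cls_relation) (auto simp: rels_def)
  then show "base (f \<otimes>\<^bsub>F\<^esub> g) = base f \<otimes>\<^bsub>E\<^esub> base g"
    using fg by (simp add: base_def cls_append)
qed simp

sublocale base: group_hom F E base
  by unfold_locales (rule base_hom)

lemma inv_stable: "inv\<^bsub>E\<^esub> stable_letter = cls [(None, False)]"
proof (rule E.inv_equality)
  have "cls [(None, False), (None, True)] = cls []"
    using pres_rel.cancel[of "[]" gens "[]" None False rels] by (intro cls_eqI) simp
  then show "cls [(None, False)] \<otimes>\<^bsub>E\<^esub> stable_letter = \<one>\<^bsub>E\<^esub>"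
    by (simp add: stable_letter_def cls_append cls_Nil)
qed simp_all

lemma stable_conj:
  assumes "f \<in> carrier F"
  shows "stable_letter \<otimes>\<^bsub>E\<^esub> base f \<otimes>\<^bsub>E\<^esub> inv\<^bsub>E\<^esub> stable_letter = base (\<phi> f)"
proof -
  have "cls [(None, True), (Some f, True), (None, False)] = cls [(Some (\<phi> f), True)]"
    using assms by (intro cls_relation) (auto simp: rels_def)
  then show ?thesis
    unfolding inv_stable using assms by (simp add: stable_letter_def base_def cls_append)
qed

lemma stable_exponent_pres_rel:
  "(u, v) \<in> pres_rel gens rels \<Longrightarrow> stable_exponent u = stable_exponent v"
proof (induction rule: pres_rel.induct)
  case (cancel u v x b)
  then show ?case by (cases x; cases b) auto
next
  case (relation r s u v)
  then show ?case by (auto simp: rels_def)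
qed auto

text \<open>
  The homomorphism to \<open>\<int>\<close> that kills \<open>F\<close> and sends the stable letter to 1; every word in a class has
  the same exponent, so any representative may be read off.
\<close>

definition exponent :: "'a option word set \<Rightarrow> int" where
  "exponent A = stable_exponent (SOME u. u \<in> A)"

lemma exponent_cls: "w \<in> words gens \<Longrightarrow> exponent (cls w) = stable_exponent w"
proof -
  assume w: "w \<in> words gens"
  then have "w \<in> cls w" by (simp add: cls_def pres_rel.refl)
  then have "(SOME u. u \<in> cls w) \<in> cls w" by (rule someI)
  then show ?thesis
    using stable_exponent_pres_rel by (auto simp: exponent_def cls_def)
qed

lemma exponent_mult:
  "A \<in> carrier E \<Longrightarrow> B \<in> carrier E \<Longrightarrow> exponent (A \<otimes>\<^bsub>E\<^esub> B) = exponent A + exponent B"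
  by (auto simp: carrier_E cls_append exponent_cls)

lemma exponent_base: "f \<in> carrier F \<Longrightarrow> exponent (base f) = 0"
  by (simp add: base_def exponent_cls)

lemma exponent_stable: "exponent stable_letter = 1"
  by (simp add: stable_letter_def exponent_cls)

end

section \<open>The base group embeds\<close>

locale ascending_HNN_extension = endomorphism_HNN +
  assumes inj_\<phi>: "inj_on \<phi> (carrier F)"
begin

definition coset_rep :: "'a \<Rightarrow> 'a" where
  "coset_rep y = (SOME z. z \<in> \<phi> ` carrier F #>\<^bsub>F\<^esub> y)"

definition transversal :: "'a set" where
  "transversal = coset_rep ` carrier F"

lemma image_subgroup: "subgroup (\<phi> ` carrier F) F"
  by (rule \<phi>.img_is_subgroup)

lemma coset_rep_in: "y \<in> carrier F \<Longrightarrow> coset_rep y \<in> \<phi> ` carrier F #>\<^bsub>F\<^esub> y"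
  unfolding coset_rep_def by (rule someI) (rule F.rcos_self[OF _ image_subgroup])

lemma transversal_carrier: "q \<in> transversal \<Longrightarrow> q \<in> carrier F"
  using coset_rep_in F.r_coset_subset_G[OF subgroup.subset[OF image_subgroup]]
  by (auto simp: transversal_def)

lemma transversal_decomposition:
  assumes "y \<in> carrier F"
  shows "\<exists>x\<in>carrier F. \<exists>q\<in>transversal. y = \<phi> x \<otimes>\<^bsub>F\<^esub> q"
proof -
  obtain a where a: "a \<in> carrier F" "coset_rep y = \<phi> a \<otimes>\<^bsub>F\<^esub> y"
    using coset_rep_in[OF assms] by (auto simp: r_coset_def)
  then have "y = \<phi> (inv\<^bsub>F\<^esub> a) \<otimes>\<^bsub>F\<^esub> coset_rep y"
    using assms by (simp flip: F.m_assoc)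
  then show ?thesis using a(1) assms unfolding transversal_def by blast
qed

text \<open>
  Both sides lie in the right coset of the image that \<open>q\<close> and \<open>q'\<close> represent, so \<open>q = q'\<close>; cancelling it
  leaves \<open>\<phi>(x) = \<phi>(x')\<close>, and injectivity applies.
\<close>

lemma transversal_unique:
  assumes "x \<in> carrier F" "x' \<in> carrier F" "q \<in> transversal" "q' \<in> transversal"
    and eq: "\<phi> x \<otimes>\<^bsub>F\<^esub> q = \<phi> x' \<otimes>\<^bsub>F\<^esub> q'"
  shows "x = x' \<and> q = q'"
proof -
  have coset: "\<phi> ` carrier F #>\<^bsub>F\<^esub> (\<phi> x \<otimes>\<^bsub>F\<^esub> coset_rep y) = \<phi> ` carrier F #>\<^bsub>F\<^esub> y"
    if "x \<in> carrier F" "y \<in> carrier F" for x y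
  proof -
    have "\<phi> x \<otimes>\<^bsub>F\<^esub> coset_rep y \<in> \<phi> ` carrier F #>\<^bsub>F\<^esub> y"
      using coset_rep_in[OF that(2)] that by (auto simp: r_coset_def simp flip: F.m_assoc \<phi>.hom_mult)
    then show ?thesis using that image_subgroup by (intro F.repr_independence[symmetric])
  qed
  obtain y y' where y: "y \<in> carrier F" "y' \<in> carrier F" "q = coset_rep y" "q' = coset_rep y'"
    using assms by (auto simp: transversal_def)
  then have "\<phi> ` carrier F #>\<^bsub>F\<^esub> y = \<phi> ` carrier F #>\<^bsub>F\<^esub> y'"
    using coset assms by metis
  then have "q = q'" by (simp add: y coset_rep_def)
  then have "\<phi> x = \<phi> x'" using eq assms transversal_carrier by simp
  then show ?thesis using \<open>q = q'\<close> inj_\<phi> assms by (auto dest: inj_onD)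
qed

text \<open>
  To see that \<open>F\<close> embeds, let it act on \<open>F \<times> Q\<^sup>\<nat>\<close> by left multiplication on the first factor, where \<open>Q\<close>
  is the transversal. The stable letter must be a bijection that carries this action to its twist by
  \<open>\<phi>\<close>. Since each element of \<open>F\<close> is uniquely \<open>\<phi>(x) q\<close>, the map \<open>(x, s) \<mapsto> (\<phi>(x) s\<^sub>0, (s\<^sub>1, s\<^sub>2, \<dots>))\<close>
  is one; the sequence stores the coset information that \<open>\<phi>\<close> alone would miss.
\<close>

definition tower :: "('a \<times> (nat \<Rightarrow> 'a)) set" where
  "tower = carrier F \<times> {s. \<forall>n. s n \<in> transversal}"

definition shift :: "'a \<times> (nat \<Rightarrow> 'a) \<Rightarrow> 'a \<times> (nat \<Rightarrow> 'a)" where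
  "shift = (\<lambda>(x, s). (\<phi> x \<otimes>\<^bsub>F\<^esub> s 0, \<lambda>n. s (Suc n)))"

lemma bij_shift: "bij_betw shift tower tower"
proof (rule bij_betw_imageI)
  show "inj_on shift tower"
  proof (rule inj_onI, clarify)
    fix x s x' s'
    assume "(x, s) \<in> tower" "(x', s') \<in> tower" "shift (x, s) = shift (x', s')"
    then have "x = x' \<and> s 0 = s' 0" "\<And>n. s (Suc n) = s' (Suc n)"
      using transversal_unique[of x x' "s 0" "s' 0"] by (auto simp: tower_def shift_def fun_eq_iff)
    then show "x = x' \<and> s = s'" by (metis ext not0_implies_Suc)
  qed
  show "shift ` tower = tower"
  proof
    show "shift ` tower \<subseteq> tower"
      using transversal_carrier by (auto simp: tower_def shift_def)
    show "tower \<subseteq> shift ` tower"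
    proof clarify
      fix y s assume ys: "(y, s) \<in> tower"
      then obtain x q where "x \<in> carrier F" "q \<in> transversal" "y = \<phi> x \<otimes>\<^bsub>F\<^esub> q"
        using transversal_decomposition[of y] by (auto simp: tower_def)
      then show "(y, s) \<in> shift ` tower"
        using ys by (intro image_eqI[of _ _ "(x, case_nat q s)"])
          (auto simp: shift_def tower_def split: nat.split)
    qed
  qed
qed

fun letter_action :: "'a option \<times> bool \<Rightarrow> 'a \<times> (nat \<Rightarrow> 'a) \<Rightarrow> 'a \<times> (nat \<Rightarrow> 'a)" where
  "letter_action (Some f, b) (x, s) = ((if b then f else inv\<^bsub>F\<^esub> f) \<otimes>\<^bsub>F\<^esub> x, s)"
| "letter_action (None, b) \<omega> = (if b then shift \<omega> else inv_into tower shift \<omega>)"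

lemma letter_action_tower:
  "fst l \<in> gens \<Longrightarrow> \<omega> \<in> tower \<Longrightarrow> letter_action l \<omega> \<in> tower"
  using bij_betwE[OF bij_shift] bij_betwE[OF bij_betw_inv_into[OF bij_shift]]
  by (cases "(l, \<omega>)" rule: letter_action.cases) (auto simp: tower_def)

lemma word_action_tower:
  "w \<in> words gens \<Longrightarrow> \<omega> \<in> tower \<Longrightarrow> foldr letter_action w \<omega> \<in> tower"
  by (induction w) (auto simp: letter_action_tower)

lemma letter_action_cancel:
  assumes "x \<in> gens" "\<omega> \<in> tower"
  shows "letter_action (x, b) (letter_action (x, \<not> b) \<omega>) = \<omega>"
proof (cases x)
  case None
  then show ?thesis
    using assms bij_betw_inv_into_left[OF bij_shift] bij_betw_inv_into_right[OF bij_shift] by auto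
next
  case (Some f)
  then show ?thesis
    using assms by (cases \<omega>) (auto simp: tower_def simp flip: F.m_assoc)
qed

lemma relation_action:
  assumes "(r, s) \<in> rels" "\<omega> \<in> tower"
  shows "foldr letter_action r \<omega> = foldr letter_action s \<omega>"
proof -
  consider (mult) f g where "f \<in> carrier F" "g \<in> carrier F"
      "r = [(Some f, True), (Some g, True)]" "s = [(Some (f \<otimes>\<^bsub>F\<^esub> g), True)]"
    | (conj) f where "f \<in> carrier F"
      "r = [(None, True), (Some f, True), (None, False)]" "s = [(Some (\<phi> f), True)]"
    using assms(1) by (auto simp: rels_def)
  then show ?thesis
  proof cases
    case mult
    then show ?thesis using assms(2) by (cases \<omega>) (auto simp: tower_def F.m_assoc)
  next
    case conj
    have shift_mult: "shift (letter_action (Some f, True) \<nu>) = letter_action (Some (\<phi> f), True) (shift \<nu>)"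
      if "\<nu> \<in> tower" for \<nu>
      using that conj(1) transversal_carrier by (cases \<nu>) (auto simp: tower_def shift_def F.m_assoc)
    have "inv_into tower shift \<omega> \<in> tower"
      using assms(2) bij_betwE[OF bij_betw_inv_into[OF bij_shift]] by blast
    then show ?thesis
      using conj shift_mult assms(2) bij_betw_inv_into_right[OF bij_shift] by simp
  qed
qed

lemma pres_rel_action:
  "(u, v) \<in> pres_rel gens rels \<Longrightarrow> \<omega> \<in> tower \<Longrightarrow> foldr letter_action u \<omega> = foldr letter_action v \<omega>"
proof (induction arbitrary: \<omega> rule: pres_rel.induct)
  case (cancel u v x b)
  then show ?case using letter_action_cancel word_action_tower by simp
next
  case (relation r s u v)
  then show ?case using relation_action word_action_tower by simp
qed auto

text \<open>
  Elements of \<open>F\<close> with equal image act alike on a point with first coordinate 1, and their effect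
  on it displays them.
\<close>

lemma inj_base: "inj_on base (carrier F)"
proof (rule inj_onI)
  fix f g assume fg: "f \<in> carrier F" "g \<in> carrier F" "base f = base g"
  have "(\<one>\<^bsub>F\<^esub>, \<lambda>_. coset_rep \<one>\<^bsub>F\<^esub>) \<in> tower"
    by (auto simp: tower_def transversal_def)
  moreover have "([(Some f, True)], [(Some g, True)]) \<in> pres_rel gens rels"
    using fg by (intro eq_equiv_class[OF _ equiv_pres_rel]) (auto simp: base_def cls_def)
  ultimately show "f = g" using pres_rel_action fg by fastforce
qed

end

section \<open>Failure of the finitely generated intersection property\<close>

text \<open>
  The witnesses are \<open>\<langle>f, y\<rangle>\<close> and \<open>F\<close> with \<open>y = w t\<close>; independence of the orbit of \<open>f\<close> in \<open>F\<close> carries over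
  to the extension because \<open>base\<close> is injective.
\<close>

lemma (in ascending_HNN_extension) not_FGIP:
  assumes w: "w \<in> carrier F" and f: "f \<in> carrier F"
    and A: "finite A" "A \<subseteq> carrier F" "generate F A = carrier F"
    and orbit: "\<And>k. ((\<lambda>x. w \<otimes>\<^bsub>F\<^esub> \<phi> x \<otimes>\<^bsub>F\<^esub> inv\<^bsub>F\<^esub> w) ^^ k) f
      \<notin> generate F ((\<lambda>i. ((\<lambda>x. w \<otimes>\<^bsub>F\<^esub> \<phi> x \<otimes>\<^bsub>F\<^esub> inv\<^bsub>F\<^esub> w) ^^ i) f) ` {..<k})"
  shows "\<not> FGIP E"
proof -
  define \<psi> where "\<psi> = (\<lambda>x. w \<otimes>\<^bsub>F\<^esub> \<phi> x \<otimes>\<^bsub>F\<^esub> inv\<^bsub>F\<^esub> w)"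
  define y where "y = base w \<otimes>\<^bsub>E\<^esub> stable_letter"
  define K where "K = base ` carrier F"
  define c where "c i = y [^]\<^bsub>E\<^esub> i \<otimes>\<^bsub>E\<^esub> base f \<otimes>\<^bsub>E\<^esub> y [^]\<^bsub>E\<^esub> (- i)" for i :: int
  have yE: "y \<in> carrier E" using w by (simp add: y_def)
  have \<psi>_closed: "\<psi> x \<in> carrier F" if "x \<in> carrier F" for x
    using w that by (simp add: \<psi>_def)
  have orb: "(\<psi> ^^ i) f \<in> carrier F" for i by (induction i) (auto simp: f \<psi>_closed)
  have y_conj: "y \<otimes>\<^bsub>E\<^esub> base x \<otimes>\<^bsub>E\<^esub> inv\<^bsub>E\<^esub> y = base (\<psi> x)" if x: "x \<in> carrier F" for x
  proof -
    have "y \<otimes>\<^bsub>E\<^esub> base x \<otimes>\<^bsub>E\<^esub> inv\<^bsub>E\<^esub> y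
      = base w \<otimes>\<^bsub>E\<^esub> (stable_letter \<otimes>\<^bsub>E\<^esub> base x \<otimes>\<^bsub>E\<^esub> inv\<^bsub>E\<^esub> stable_letter) \<otimes>\<^bsub>E\<^esub> inv\<^bsub>E\<^esub> base w"
      using x w by (simp add: y_def E.inv_mult_group E.m_assoc)
    then show ?thesis using x w by (simp add: stable_conj \<psi>_def)
  qed
  have c_nat: "c (int i) = base ((\<psi> ^^ i) f)" for i
  proof (induction i)
    case 0
    then show ?case using f by (simp add: c_def)
  next
    case (Suc i)
    have "y [^]\<^bsub>E\<^esub> int (Suc i) = y \<otimes>\<^bsub>E\<^esub> y [^]\<^bsub>E\<^esub> int i"
      using E.int_pow_mult[OF yE, of 1 "int i"] yE by simp
    then have "c (int (Suc i)) = y \<otimes>\<^bsub>E\<^esub> c (int i) \<otimes>\<^bsub>E\<^esub> inv\<^bsub>E\<^esub> y"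
      using yE f by (simp add: c_def E.int_pow_neg E.inv_mult_group E.m_assoc del: of_nat_Suc)
    then show ?case using Suc y_conj orb by simp
  qed
  have "\<not> fg_subgroup (generate E {base f, y} \<inter> K) E"
  proof (rule E.not_fg_intersection[where \<chi> = exponent])
    show "subgroup K E" unfolding K_def by (rule base.img_is_subgroup)
    show "exponent k = 0" if "k \<in> K" for k using that by (auto simp: K_def exponent_base)
    show "exponent y \<noteq> 0" using w by (simp add: y_def exponent_mult exponent_base exponent_stable)
    show "y [^]\<^bsub>E\<^esub> i \<otimes>\<^bsub>E\<^esub> base f \<otimes>\<^bsub>E\<^esub> y [^]\<^bsub>E\<^esub> (- i) \<in> K" if "i \<ge> 0" for i :: int
      using c_nat[of "nat i"] that orb by (simp add: c_def K_def)
    show "y [^]\<^bsub>E\<^esub> int k \<otimes>\<^bsub>E\<^esub> base f \<otimes>\<^bsub>E\<^esub> y [^]\<^bsub>E\<^esub> (- int k)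
        \<notin> generate E ((\<lambda>i. y [^]\<^bsub>E\<^esub> int i \<otimes>\<^bsub>E\<^esub> base f \<otimes>\<^bsub>E\<^esub> y [^]\<^bsub>E\<^esub> (- int i)) ` {..<k})" for k
    proof -
      let ?O = "(\<lambda>i. (\<psi> ^^ i) f) ` {..<k}"
      have O: "?O \<subseteq> carrier F" using orb by auto
      have "base ((\<psi> ^^ k) f) \<notin> base ` generate F ?O"
        using orbit[of k] inj_base orb[of k] F.generate_incl[OF O]
        by (auto simp: \<psi>_def[symmetric] dest: inj_onD)
      also have "base ` generate F ?O = generate E ((\<lambda>i. base ((\<psi> ^^ i) f)) ` {..<k})"
        using base.generate_img[OF O] by (simp add: image_image)
      finally show ?thesis by (simp flip: c_nat add: c_def)
    qed
  qed (use yE f exponent_mult in auto)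
  moreover have "fg_subgroup K E"
    unfolding fg_subgroup_def K_def
    using A base.generate_img[OF A(2)] by (intro exI[of _ "base ` A"]) auto
  moreover have "fg_subgroup (generate E {base f, y}) E"
    unfolding fg_subgroup_def using f yE by (intro exI[of _ "{base f, y}"]) auto
  ultimately show ?thesis by (auto simp: FGIP_def)
qed

text \<open>
  The extension is presented over the elements of \<open>F\<close> itself, so the orbit is carried from the reduced
  words to \<open>F\<close>, and not the extension from \<open>F\<close> to the reduced words.
\<close>

lemma independent_orbit_iso:
  assumes "group F" and S: "finite S" "card S \<ge> 2" and k: "k \<in> iso (reduced_words S) F"
    and \<phi>: "\<phi> \<in> hom F F" "inj_on \<phi> (carrier F)"
  obtains w f where "w \<in> carrier F" "f \<in> carrier F"
    "\<And>n. ((\<lambda>x. w \<otimes>\<^bsub>F\<^esub> \<phi> x \<otimes>\<^bsub>F\<^esub> inv\<^bsub>F\<^esub> w) ^^ n) f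
      \<notin> generate F ((\<lambda>i. ((\<lambda>x. w \<otimes>\<^bsub>F\<^esub> \<phi> x \<otimes>\<^bsub>F\<^esub> inv\<^bsub>F\<^esub> w) ^^ i) f) ` {..<n})"
proof -
  define W where "W = reduced_words S"
  interpret F: group F by fact
  interpret W: group W unfolding W_def by (rule group_reduced_words)
  interpret k: group_hom W F k
    using k by unfold_locales (simp add: iso_def W_def)
  have bij: "bij_betw k (carrier W) (carrier F)" using k by (simp add: iso_def W_def)
  define \<Phi> where "\<Phi> = inv_into (carrier W) k \<circ> \<phi> \<circ> k"
  have k': "inv_into (carrier W) k \<in> hom F W"
    using W.iso_set_sym[of k F] k by (simp add: iso_def W_def)
  have \<Phi>: "\<Phi> \<in> hom W W"
    unfolding \<Phi>_def using k.homh \<phi>(1) k' by (intro Group.hom_compose) auto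
  have k_\<Phi>: "k (\<Phi> x) = \<phi> (k x)" if "x \<in> carrier W" for x
    using that \<phi>(1) bij_betw_inv_into_right[OF bij] by (auto simp: \<Phi>_def hom_def Pi_def)
  have "inj_on \<Phi> (carrier W)"
  proof (rule inj_onI)
    fix x x' assume x: "x \<in> carrier W" "x' \<in> carrier W" "\<Phi> x = \<Phi> x'"
    then have "\<phi> (k x) = \<phi> (k x')" by (metis k_\<Phi>)
    then show "x = x'" using x \<phi>(2) bij by (auto simp: bij_betw_def dest!: inj_onD)
  qed
  moreover obtain \<alpha> \<beta> where "\<alpha> \<in> S" "\<beta> \<in> S" "\<alpha> \<noteq> \<beta>"
  proof -
    obtain T where "T \<subseteq> S" "card T = 2" using S obtain_subset_with_card_n by metis
    then show thesis using that by (auto simp: card_2_iff)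
  qed
  ultimately obtain w f where wf: "w \<in> carrier W" "f \<in> carrier W" and
    orbit: "\<And>n. ((\<lambda>x. w \<otimes>\<^bsub>W\<^esub> \<Phi> x \<otimes>\<^bsub>W\<^esub> inv\<^bsub>W\<^esub> w) ^^ n) f
      \<notin> generate W ((\<lambda>i. ((\<lambda>x. w \<otimes>\<^bsub>W\<^esub> \<Phi> x \<otimes>\<^bsub>W\<^esub> inv\<^bsub>W\<^esub> w) ^^ i) f) ` {..<n})"
    using reduced_words_independent_orbit[of S \<alpha> \<beta> \<Phi>] S(1) \<Phi> unfolding W_def by blast
  define \<Psi> where "\<Psi> = (\<lambda>x. w \<otimes>\<^bsub>W\<^esub> \<Phi> x \<otimes>\<^bsub>W\<^esub> inv\<^bsub>W\<^esub> w)"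
  define \<psi> where "\<psi> = (\<lambda>x. k w \<otimes>\<^bsub>F\<^esub> \<phi> x \<otimes>\<^bsub>F\<^esub> inv\<^bsub>F\<^esub> k w)"
  have \<Phi>_closed: "\<Phi> x \<in> carrier W" if "x \<in> carrier W" for x using \<Phi> that by (auto simp: hom_def)
  have \<Psi>_closed: "\<Psi> x \<in> carrier W" if "x \<in> carrier W" for x
    using that wf \<Phi>_closed by (simp add: \<Psi>_def)
  have orb: "(\<Psi> ^^ i) f \<in> carrier W" for i by (induction i) (auto simp: wf \<Psi>_closed)
  have "k (\<Psi> x) = \<psi> (k x)" if "x \<in> carrier W" for x
    using that wf by (simp add: \<Psi>_def \<psi>_def k_\<Phi> \<Phi>_closed)
  then have k_orb: "k ((\<Psi> ^^ i) f) = (\<psi> ^^ i) (k f)" for i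
    by (induction i) (auto simp: orb)
  have "(\<psi> ^^ n) (k f) \<notin> generate F ((\<lambda>i. (\<psi> ^^ i) (k f)) ` {..<n})" for n
  proof -
    let ?O = "(\<lambda>i. (\<Psi> ^^ i) f) ` {..<n}"
    have O: "?O \<subseteq> carrier W" using orb by auto
    have "k ((\<Psi> ^^ n) f) \<notin> k ` generate W ?O"
      using orbit[of n] bij orb[of n] W.generate_incl[OF O]
      by (auto simp: \<Psi>_def[symmetric] bij_betw_def dest: inj_onD)
    also have "k ` generate W ?O = generate F (k ` ?O)"
      using k.generate_img[OF O] by simp
    finally show ?thesis by (simp add: image_image k_orb)
  qed
  then show thesis
    using that[of "k w" "k f"] wf by (simp add: \<psi>_def)
qed

theorem theorem2p3:
  fixes F :: "('a, 'm) monoid_scheme" and S :: "'b set" and \<phi> :: "'a \<Rightarrow> 'a"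
  assumes "group F"
    and "finite S" and "card S \<ge> 2" and "F \<cong> free_group S"
    and "\<phi> \<in> hom F F" and "inj_on \<phi> (carrier F)"
  shows "\<not> FGIP (ascending_HNN F \<phi>)"
proof -
  interpret G: ascending_HNN_extension F \<phi>
    using assms by (intro ascending_HNN_extension.intro endomorphism_HNN.intro endomorphism_HNN_axioms.intro
        ascending_HNN_extension_axioms.intro)
  have "reduced_words S \<cong> free_group S"
    using iso_reduced_words_free_group by (rule is_isoI)
  moreover have "free_group S \<cong> F"
    using group.iso_sym[OF assms(1,4)] .
  ultimately obtain k where k: "k \<in> iso (reduced_words S) F"
    using iso_trans unfolding is_iso_def by blast
  interpret k: group_hom "reduced_words S" F k
    using k group_reduced_words[of S] assms(1)
    by (intro group_hom.intro group_hom_axioms.intro) (auto simp: iso_def)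
  let ?A = "k ` (\<lambda>l. [l]) ` (S \<times> UNIV)"
  have letters: "(\<lambda>l. [l]) ` (S \<times> UNIV) \<subseteq> carrier (reduced_words S)"
    by (auto simp: carrier_reduced_words)
  have A: "?A \<subseteq> carrier F"
    using letters k.hom_closed by blast
  have gen: "generate F ?A = carrier F"
    using k.generate_img[OF letters] generate_letters[of S] k by (simp add: iso_def bij_betw_def)
  obtain w f where "w \<in> carrier F" "f \<in> carrier F"
    "\<And>n. ((\<lambda>x. w \<otimes>\<^bsub>F\<^esub> \<phi> x \<otimes>\<^bsub>F\<^esub> inv\<^bsub>F\<^esub> w) ^^ n) f
      \<notin> generate F ((\<lambda>i. ((\<lambda>x. w \<otimes>\<^bsub>F\<^esub> \<phi> x \<otimes>\<^bsub>F\<^esub> inv\<^bsub>F\<^esub> w) ^^ i) f) ` {..<n})"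
    using independent_orbit_iso[OF assms(1-3) k assms(5,6)] by metis
  then show ?thesis
    using assms(2) gen A by (intro G.not_FGIP[of w f ?A]) auto
qed

end
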